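(* Let $(\mathsf{A},\Delta)$ be a finite quantum group. Then the lattice of idempotent states on $(\mathsf{A},\Delta)$ and the lattice of right coidalgebras in $(\mathsf{A},\Delta)$ are isomorphic.
   Context: A finite quantum group is a pair $(\mathsf{A},\Delta)$ of a finite-dimensional unital C*-algebra $\mathsf{A}$ and a unital $*$-homomorphism $\Delta:\mathsf{A}\to\mathsf{A}\otimes\mathsf{A}$ with $(\mathrm{id}\otimes\Delta)\circ\Delta=(\Delta\otimes\mathrm{id})\circ\Delta$ and such that $\mathrm{span}\{\Delta(b)(\mathbf{1}\otimes a);a,b\in\mathsf{A}\}$ and $\mathrm{span}\{\Delta(b)(a\otimes\mathbf{1});a,b\in\mathsf{A}\}$ are dense in (hence, in finite dimension, equal to) $\mathsf{A}\otimes\mathsf{A}$. The convolution product of linear functionals $\psi_1,\psi_2:\mathsf{A}\to\mathbb{C}$ is $\psi_1\star\psi_2=(\psi_1\otimes\psi_2)\circ\Delta$. A state $\phi:\mathsf{A}\to\mathbb{C}$ is idempotent if $\phi\star\phi=\phi$. Idempotent states are partially ordered by $\phi_1\prec\phi_2$ if and only if $\phi_1\star\phi_2=\phi_2$. A right coidalgebra in $(\mathsf{A},\Delta)$ is a unital $*$-subalgebra $\mathsf{C}\subseteq\mathsf{A}$ such that $\Delta(\mathsf{C})\subseteq\mathsf{A}\otimes\mathsf{C}$. No special order on right coidalgebras is introduced; the usual order on a lattice of subalgebras is inclusion.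
   Formalization: Right coidalgebras are ordered by reverse inclusion; with plain inclusion the claim fails, e.g. for functions on the alternating group A_4, whose subgroup lattice (7 atoms, 5 coatoms) is not self-dual. *)

theory Defs
  imports Complex_Main "HOL-Library.Nonpos_Ints" "HOL-Algebra.Lattice"
begin

section \<open>Complex vector spaces and C*-algebras\<close>

class scaleC =
  fixes scaleC :: "complex \<Rightarrow> 'a \<Rightarrow> 'a" (infixr \<open>*\<^sub>C\<close> 75)

class complex_vector = scaleC + ab_group_add +
  assumes scaleC_add_right: "c *\<^sub>C (x + y) = c *\<^sub>C x + c *\<^sub>C y"
    and scaleC_add_left: "(c + d) *\<^sub>C x = c *\<^sub>C x + d *\<^sub>C x"
    and scaleC_scaleC: "c *\<^sub>C d *\<^sub>C x = (c * d) *\<^sub>C x"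
    and scaleC_one: "1 *\<^sub>C x = x"

global_interpretation cvs: vector_space "scaleC :: complex \<Rightarrow> 'a \<Rightarrow> 'a::complex_vector"
  by unfold_locales (simp_all add: scaleC_add_right scaleC_add_left scaleC_scaleC scaleC_one)

abbreviation clinear :: "('a::complex_vector \<Rightarrow> 'b::complex_vector) \<Rightarrow> bool" where
  "clinear \<equiv> Vector_Spaces.linear scaleC scaleC"

abbreviation cspan :: "'a::complex_vector set \<Rightarrow> 'a set" where
  "cspan \<equiv> module.span scaleC"

abbreviation csubspace :: "'a::complex_vector set \<Rightarrow> bool" where
  "csubspace \<equiv> module.subspace scaleC"

definition cbilinear :: "('a::complex_vector \<Rightarrow> 'b::complex_vector \<Rightarrow> 'c::complex_vector) \<Rightarrow> bool" where
  "cbilinear \<beta> \<longleftrightarrow> (\<forall>a. clinear (\<beta> a)) \<and> (\<forall>b. clinear (\<lambda>a. \<beta> a b))"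

instantiation complex :: complex_vector
begin
definition scaleC_complex_def: "(c::complex) *\<^sub>C (z::complex) = c * z"
instance by standard (simp_all add: scaleC_complex_def algebra_simps)
end

class complex_star_algebra = complex_vector + ring_1 +
  fixes star :: "'a \<Rightarrow> 'a"
  assumes mult_scaleC_left: "(c *\<^sub>C x) * y = c *\<^sub>C (x * y)"
    and mult_scaleC_right: "x * (c *\<^sub>C y) = c *\<^sub>C (x * y)"
    and star_star: "star (star x) = x"
    and star_add: "star (x + y) = star x + star y"
    and star_scaleC: "star (c *\<^sub>C x) = cnj c *\<^sub>C star x"
    and star_mult: "star (x * y) = star y * star x"

text \<open>
  Unital C*-algebras. The class \<open>ring_1\<close> contains \<open>0 \<noteq> 1\<close>, so the zero algebra, which has
  no states, is excluded.
\<close>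

class cstar_algebra = complex_star_algebra + real_normed_algebra_1 + banach +
  assumes scaleR_scaleC: "r *\<^sub>R x = complex_of_real r *\<^sub>C x"
    and norm_scaleC: "norm (c *\<^sub>C x) = cmod c * norm x"
    and norm_star_mult: "norm (star x * x) = (norm x)\<^sup>2"

definition unital_star_hom :: "('a::complex_star_algebra \<Rightarrow> 'b::complex_star_algebra) \<Rightarrow> bool" where
  "unital_star_hom f \<longleftrightarrow> clinear f \<and> f 1 = 1 \<and>
     (\<forall>x y. f (x * y) = f x * f y) \<and> (\<forall>x. f (star x) = star (f x))"

section \<open>The algebraic tensor product\<close>

text \<open>
  Elements are formal sums of elementary tensors, represented by lists of pairs (scalars are
  absorbed into the first factor). Two formal sums are identified iff no bilinear form
  separates them; since linear functionals separate the points of a vector space, this is the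
  usual tensor product. The universal property is \<open>tensor_lift_elem\<close>, \<open>clinear_tensor_lift\<close>
  and \<open>tensor_ext\<close> below. For finite-dimensional C*-algebras the algebraic tensor product is
  already complete, and its *-algebra structure is all that is needed of the C*-tensor product.
\<close>

definition formal_eval :: "('a \<Rightarrow> 'b \<Rightarrow> 'c::comm_monoid_add) \<Rightarrow> ('a \<times> 'b) list \<Rightarrow> 'c" where
  "formal_eval \<beta> s = sum_list (map (\<lambda>(a, b). \<beta> a b) s)"

definition tensor_eq ::
    "('a::complex_vector \<times> 'b::complex_vector) list \<Rightarrow> ('a \<times> 'b) list \<Rightarrow> bool" where
  "tensor_eq s t \<longleftrightarrow>
     (\<forall>\<beta> :: 'a \<Rightarrow> 'b \<Rightarrow> complex. cbilinear \<beta> \<longrightarrow> formal_eval \<beta> s = formal_eval \<beta> t)"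

quotient_type (overloaded) ('a, 'b) tensor =
    "('a::complex_vector \<times> 'b::complex_vector) list" / tensor_eq
  by (auto intro!: equivpI reflpI sympI transpI simp: tensor_eq_def)

lemma clinear_iff:
  "clinear f \<longleftrightarrow> (\<forall>x y. f (x + y) = f x + f y) \<and> (\<forall>c x. f (c *\<^sub>C x) = c *\<^sub>C f x)"
  by (auto simp: Vector_Spaces.linear_iff cvs.vector_space_axioms)

lemma clinear_zero: "clinear f \<Longrightarrow> f 0 = 0"
  unfolding clinear_iff by (metis add_cancel_right_right)

lemma clinear_uminus: "clinear f \<Longrightarrow> f (- x) = - f x"
  using clinear_zero[of f] unfolding clinear_iff by (metis add.right_inverse add_eq_0_iff)

lemma clinear_diff: "clinear f \<Longrightarrow> f (x - y) = f x - f y"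
  using clinear_uminus[of f y] by (simp add: clinear_iff flip: add_uminus_conv_diff)

lemma cbilinear_iff:
  "cbilinear \<beta> \<longleftrightarrow>
     (\<forall>a a' b. \<beta> (a + a') b = \<beta> a b + \<beta> a' b) \<and> (\<forall>a b b'. \<beta> a (b + b') = \<beta> a b + \<beta> a b') \<and>
     (\<forall>c a b. \<beta> (c *\<^sub>C a) b = c *\<^sub>C \<beta> a b) \<and> (\<forall>c a b. \<beta> a (c *\<^sub>C b) = c *\<^sub>C \<beta> a b)"
  unfolding cbilinear_def clinear_iff by blast

lemma cbilinear_uminus: "cbilinear \<beta> \<Longrightarrow> \<beta> (- a) b = - \<beta> a b"
  unfolding cbilinear_def using clinear_uminus[of "\<lambda>a. \<beta> a b"] by blast

lemma formal_eval_simps [simp]: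
  "formal_eval \<beta> [] = 0"
  "formal_eval \<beta> ((a, b) # s) = \<beta> a b + formal_eval \<beta> s"
  "formal_eval \<beta> (s @ t) = formal_eval \<beta> s + formal_eval \<beta> t"
  by (simp_all add: formal_eval_def)

lemma formal_eval_map:
  "formal_eval \<beta> (map (\<lambda>(a, b). (f a b, g a b)) s) = formal_eval (\<lambda>a b. \<beta> (f a b) (g a b)) s"
  by (simp add: formal_eval_def o_def case_prod_unfold)

lemma formal_eval_add:
  "formal_eval (\<lambda>a b. \<beta> a b + \<gamma> a b) s = formal_eval \<beta> s + formal_eval \<gamma> s"
  by (induction s) (auto simp: add_ac)

lemma formal_eval_hom:
  assumes "f 0 = 0" "\<And>x y. f (x + y) = f x + f y"
  shows "f (formal_eval \<beta> s) = formal_eval (\<lambda>a b. f (\<beta> a b)) s"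
  by (induction s) (auto simp: assms)

lemma formal_eval_scaleC:
  fixes \<beta> :: "'a \<Rightarrow> 'b \<Rightarrow> 'c::complex_vector"
  shows "formal_eval (\<lambda>a b. c *\<^sub>C \<beta> a b) s = c *\<^sub>C formal_eval \<beta> s"
  by (induction s) (auto simp: scaleC_add_right)

lemma formal_eval_uminus:
  fixes \<beta> :: "'a \<Rightarrow> 'b \<Rightarrow> 'c::ab_group_add"
  shows "formal_eval (\<lambda>a b. - \<beta> a b) s = - formal_eval \<beta> s"
  by (induction s) auto

lemma formal_eval_zero [simp]: "formal_eval (\<lambda>a b. 0) s = 0"
  by (induction s) auto

instantiation tensor :: (complex_vector, complex_vector) complex_vector
begin

lift_definition zero_tensor :: "('a, 'b) tensor" is "[]" .

lift_definition plus_tensor :: "('a, 'b) tensor \<Rightarrow> ('a, 'b) tensor \<Rightarrow> ('a, 'b) tensor" is "(@)"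
  by (simp add: tensor_eq_def)

lift_definition scaleC_tensor :: "complex \<Rightarrow> ('a, 'b) tensor \<Rightarrow> ('a, 'b) tensor"
  is "\<lambda>c. map (\<lambda>(a, b). (c *\<^sub>C a, b))"
  by (simp add: tensor_eq_def formal_eval_map cbilinear_iff formal_eval_scaleC)

lift_definition uminus_tensor :: "('a, 'b) tensor \<Rightarrow> ('a, 'b) tensor"
  is "map (\<lambda>(a, b). (- a, b))"
  by (simp add: tensor_eq_def formal_eval_map cbilinear_uminus formal_eval_uminus)

definition minus_tensor :: "('a, 'b) tensor \<Rightarrow> ('a, 'b) tensor \<Rightarrow> ('a, 'b) tensor" where
  "minus_tensor x y = x + - y"

instance
proof
  fix x y z :: "('a, 'b) tensor" and c d :: complex
  show "x + y + z = x + (y + z)" by transfer (simp add: tensor_eq_def)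
  show "x + y = y + x" by transfer (simp add: tensor_eq_def)
  show "0 + x = x" by transfer (simp add: tensor_eq_def)
  show "- x + x = 0"
    by transfer (simp add: tensor_eq_def formal_eval_map cbilinear_uminus formal_eval_uminus)
  show "x - y = x + - y" by (rule minus_tensor_def)
  show "c *\<^sub>C (x + y) = c *\<^sub>C x + c *\<^sub>C y" by transfer (simp add: tensor_eq_def)
  show "(c + d) *\<^sub>C x = c *\<^sub>C x + d *\<^sub>C x"
    by transfer (simp add: tensor_eq_def formal_eval_map cbilinear_iff formal_eval_add
        scaleC_add_left)
  show "c *\<^sub>C d *\<^sub>C x = (c * d) *\<^sub>C x"
    by transfer (simp add: tensor_eq_def formal_eval_map scaleC_scaleC del: map_map)
  show "1 *\<^sub>C x = x"
    by transfer (simp add: tensor_eq_def formal_eval_map scaleC_one)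
qed

end

lift_definition tensor_elem :: "'a::complex_vector \<Rightarrow> 'b::complex_vector \<Rightarrow> ('a, 'b) tensor"
    (infixr \<open>\<otimes>\<^sub>C\<close> 72) is "\<lambda>a b. [(a, b)]" .

text \<open>
  The linear map induced by a bilinear map. The chosen representative is irrelevant when
  \<open>\<beta>\<close> is bilinear.
\<close>

definition tensor_lift ::
    "('a::complex_vector \<Rightarrow> 'b::complex_vector \<Rightarrow> 'c::complex_vector) \<Rightarrow> ('a, 'b) tensor \<Rightarrow> 'c" where
  "tensor_lift \<beta> t = formal_eval \<beta> (rep_tensor t)"

lemma exists_separating_functional:
  fixes x :: "'a::complex_vector"
  assumes "x \<noteq> 0"
  obtains f :: "'a \<Rightarrow> complex" where "clinear f" "f x = 1"
proof -
  interpret p: vector_space_pair "scaleC :: complex \<Rightarrow> 'a \<Rightarrow> 'a"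
    "scaleC :: complex \<Rightarrow> complex \<Rightarrow> complex" ..
  have "\<not> module.dependent scaleC {x}"
    using assms by simp
  from p.linear_independent_extend[OF this, of "\<lambda>_. 1"] show ?thesis
    using that by auto
qed

lemma cbilinear_compose:
  assumes "cbilinear \<beta>" "clinear f"
  shows "cbilinear (\<lambda>a b. f (\<beta> a b))"
  using assms by (simp add: cbilinear_iff clinear_iff)

lemma tensor_lift_abs:
  assumes "cbilinear \<beta>"
  shows "tensor_lift \<beta> (abs_tensor s) = formal_eval \<beta> s"
proof (rule ccontr)
  let ?r = "rep_tensor (abs_tensor s)"
  assume "tensor_lift \<beta> (abs_tensor s) \<noteq> formal_eval \<beta> s"
  then have "formal_eval \<beta> ?r - formal_eval \<beta> s \<noteq> 0"
    by (simp add: tensor_lift_def)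
  then obtain f :: "_ \<Rightarrow> complex"
    where f: "clinear f" and f1: "f (formal_eval \<beta> ?r - formal_eval \<beta> s) = 1"
    by (rule exists_separating_functional)
  have "tensor_eq ?r s"
    by (rule Quotient3_rep_abs[OF Quotient3_tensor]) (simp add: tensor_eq_def)
  then have "formal_eval (\<lambda>a b. f (\<beta> a b)) ?r = formal_eval (\<lambda>a b. f (\<beta> a b)) s"
    using cbilinear_compose[OF assms f] by (simp add: tensor_eq_def)
  then have "f (formal_eval \<beta> ?r) = f (formal_eval \<beta> s)"
    using f by (simp add: formal_eval_hom clinear_zero clinear_iff)
  with f1 show False
    using clinear_diff[OF f] by simp
qed

lemma tensor_lift_elem:
  "cbilinear \<beta> \<Longrightarrow> tensor_lift \<beta> (a \<otimes>\<^sub>C b) = \<beta> a b"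
  by (simp add: tensor_elem.abs_eq tensor_lift_abs)

lemma clinear_tensor_lift:
  assumes "cbilinear \<beta>"
  shows "clinear (tensor_lift \<beta>)"
  unfolding clinear_iff
proof (intro conjI allI)
  fix x y :: "('a, 'b) tensor" and c :: complex
  obtain s t where [simp]: "x = abs_tensor s" "y = abs_tensor t"
    by (metis Quotient3_abs_rep[OF Quotient3_tensor])
  show "tensor_lift \<beta> (x + y) = tensor_lift \<beta> x + tensor_lift \<beta> y"
    by (simp add: plus_tensor.abs_eq tensor_lift_abs assms)
  show "tensor_lift \<beta> (c *\<^sub>C x) = c *\<^sub>C tensor_lift \<beta> x"
    using assms
    by (simp add: scaleC_tensor.abs_eq tensor_lift_abs formal_eval_map)
      (simp add: cbilinear_iff formal_eval_scaleC)
qed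

lemma cbilinear_tensor_elem: "cbilinear (\<otimes>\<^sub>C)"
  unfolding cbilinear_iff
proof (intro conjI allI; transfer)
qed (simp_all add: tensor_eq_def cbilinear_iff)

lemma abs_tensor_eq: "abs_tensor s = formal_eval (\<otimes>\<^sub>C) s"
proof (induction s)
  case Nil
  then show ?case by (simp add: zero_tensor.abs_eq)
next
  case (Cons p s)
  obtain a b where p: "p = (a, b)" by force
  have "abs_tensor (p # s) = a \<otimes>\<^sub>C b + abs_tensor s"
    by (simp add: p tensor_elem.abs_eq plus_tensor.abs_eq)
  with Cons p show ?case by simp
qed

lemma tensor_ext:
  fixes f g :: "('a::complex_vector, 'b::complex_vector) tensor \<Rightarrow> 'c::complex_vector"
  assumes "clinear f" "clinear g" "\<And>a b. f (a \<otimes>\<^sub>C b) = g (a \<otimes>\<^sub>C b)"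
  shows "f = g"
proof
  fix x :: "('a, 'b) tensor"
  obtain s where "x = abs_tensor s"
    by (metis Quotient3_abs_rep[OF Quotient3_tensor])
  then have "x = formal_eval (\<otimes>\<^sub>C) s" by (simp add: abs_tensor_eq)
  then show "f x = g x"
    using assms by (simp add: formal_eval_hom clinear_zero clinear_iff)
qed

definition tensor_map :: "('a::complex_vector \<Rightarrow> 'c::complex_vector) \<Rightarrow>
    ('b::complex_vector \<Rightarrow> 'd::complex_vector) \<Rightarrow> ('a, 'b) tensor \<Rightarrow> ('c, 'd) tensor" where
  "tensor_map f g = tensor_lift (\<lambda>a b. f a \<otimes>\<^sub>C g b)"

definition tensor_assoc :: "(('a::complex_vector, 'b::complex_vector) tensor,
    'c::complex_vector) tensor \<Rightarrow> ('a, ('b, 'c) tensor) tensor" where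
  "tensor_assoc = tensor_lift (\<lambda>t c. tensor_lift (\<lambda>a b. a \<otimes>\<^sub>C b \<otimes>\<^sub>C c) t)"

text \<open>The *-algebra structure of a tensor product of *-algebras.\<close>

lemma formal_eval_prod:
  "formal_eval \<beta> (concat (map (\<lambda>(a, b). map (\<lambda>(c, d). (f a c, g b d)) t) s)) =
     formal_eval (\<lambda>a b. formal_eval (\<lambda>c d. \<beta> (f a c) (g b d)) t) s"
  by (induction s) (auto simp: formal_eval_map)

lemma formal_eval_swap:
  "formal_eval (\<lambda>a b. formal_eval (\<lambda>c d. F a b c d) t) s =
     formal_eval (\<lambda>c d. formal_eval (\<lambda>a b. F a b c d) s) t"
  by (induction s) (auto simp: formal_eval_add)

instantiation tensor :: (complex_star_algebra, complex_star_algebra) complex_star_algebra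
begin

lift_definition one_tensor :: "('a, 'b) tensor" is "[(1, 1)]" .

lift_definition times_tensor :: "('a, 'b) tensor \<Rightarrow> ('a, 'b) tensor \<Rightarrow> ('a, 'b) tensor"
  is "\<lambda>s t. concat (map (\<lambda>(a, b). map (\<lambda>(c, d). (a * c, b * d)) t) s)"
proof -
  fix s s' t t' :: "('a \<times> 'b) list"
  assume s: "tensor_eq s s'" and t: "tensor_eq t t'"
  let ?P = "\<lambda>s t. concat (map (\<lambda>(a, b). map (\<lambda>(c, d). (a * c, b * d)) t) s)"
  show "tensor_eq (?P s t) (?P s' t')"
    unfolding tensor_eq_def
  proof (intro allI impI)
    fix \<beta> :: "'a \<Rightarrow> 'b \<Rightarrow> complex"
    assume \<beta>: "cbilinear \<beta>"
    have r: "cbilinear (\<lambda>a b. \<beta> (a * c) (b * d))" for c d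
      using \<beta> by (simp add: cbilinear_iff distrib_right mult_scaleC_left)
    have l: "cbilinear (\<lambda>c d. \<beta> (a * c) (b * d))" for a b
      using \<beta> by (simp add: cbilinear_iff distrib_left mult_scaleC_right)
    have "formal_eval \<beta> (?P s t) = formal_eval (\<lambda>a b. formal_eval (\<lambda>c d. \<beta> (a * c) (b * d)) t') s"
      using t l by (simp add: formal_eval_prod tensor_eq_def)
    also have "\<dots> = formal_eval (\<lambda>c d. formal_eval (\<lambda>a b. \<beta> (a * c) (b * d)) s') t'"
      using s r by (subst formal_eval_swap) (simp add: tensor_eq_def)
    also have "\<dots> = formal_eval \<beta> (?P s' t')"
      by (subst formal_eval_swap) (simp add: formal_eval_prod)
    finally show "formal_eval \<beta> (?P s t) = formal_eval \<beta> (?P s' t')" .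
  qed
qed

lift_definition star_tensor :: "('a, 'b) tensor \<Rightarrow> ('a, 'b) tensor"
  is "map (\<lambda>(a, b). (star a, star b))"
proof -
  fix s t :: "('a \<times> 'b) list"
  assume st: "tensor_eq s t"
  let ?S = "map (\<lambda>(a, b). (star a, star b))"
  show "tensor_eq (?S s) (?S t)"
    unfolding tensor_eq_def
  proof (intro allI impI)
    fix \<beta> :: "'a \<Rightarrow> 'b \<Rightarrow> complex"
    assume "cbilinear \<beta>"
    then have "cbilinear (\<lambda>a b. cnj (\<beta> (star a) (star b)))"
      by (simp add: cbilinear_iff star_add star_scaleC scaleC_complex_def)
    then have "formal_eval (\<lambda>a b. cnj (\<beta> (star a) (star b))) s =
        formal_eval (\<lambda>a b. cnj (\<beta> (star a) (star b))) t"
      using st by (simp add: tensor_eq_def)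
    then have "cnj (formal_eval (\<lambda>a b. \<beta> (star a) (star b)) s) =
        cnj (formal_eval (\<lambda>a b. \<beta> (star a) (star b)) t)"
      by (simp add: formal_eval_hom[of cnj])
    then show "formal_eval \<beta> (?S s) = formal_eval \<beta> (?S t)"
      by (simp add: formal_eval_map)
  qed
qed

instance
proof
  fix x y z :: "('a, 'b) tensor" and c :: complex
  show "x * y * z = x * (y * z)"
    by transfer (simp add: tensor_eq_def formal_eval_prod mult.assoc)
  show "1 * x = x" by transfer (simp add: tensor_eq_def formal_eval_map)
  have "concat (map (\<lambda>(a, b). [(a, b)]) s) = s" for s :: "('a \<times> 'b) list"
    by (induction s) auto
  then show "x * 1 = x" by transfer (simp add: tensor_eq_def)
  show "(x + y) * z = x * z + y * z"
    by transfer (simp add: tensor_eq_def)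
  show "x * (y + z) = x * y + x * z"
    by transfer (simp add: tensor_eq_def formal_eval_prod formal_eval_add del: map_append flip: map_append)
  show "(c *\<^sub>C x) * y = c *\<^sub>C (x * y)"
    by transfer (simp add: tensor_eq_def formal_eval_prod formal_eval_map mult_scaleC_left del: map_map)
  show "x * (c *\<^sub>C y) = c *\<^sub>C (x * y)"
    by transfer (simp add: tensor_eq_def formal_eval_prod formal_eval_map mult_scaleC_right del: map_map)
  show "star (star x) = x"
    by transfer (simp add: tensor_eq_def formal_eval_map star_star del: map_map)
  show "star (x + y) = star x + star y"
    by transfer (simp add: tensor_eq_def)
  show "star (c *\<^sub>C x) = cnj c *\<^sub>C star x"
    by transfer (simp add: tensor_eq_def formal_eval_map star_scaleC del: map_map)
  show "star (x * y) = star y * star x"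
  proof (transfer, unfold tensor_eq_def, intro allI impI)
    fix s t :: "('a \<times> 'b) list" and \<beta> :: "'a \<Rightarrow> 'b \<Rightarrow> complex"
    let ?S = "map (\<lambda>(a, b). (star a, star b))"
    let ?P = "\<lambda>s t. concat (map (\<lambda>(a, b). map (\<lambda>(c, d). (a * c, b * d)) t) s)"
    have "formal_eval \<beta> (?S (?P s t)) =
        formal_eval (\<lambda>a b. formal_eval (\<lambda>c d. \<beta> (star c * star a) (star d * star b)) t) s"
      unfolding formal_eval_map formal_eval_prod by (simp add: star_mult)
    also have "\<dots> =
        formal_eval (\<lambda>c d. formal_eval (\<lambda>a b. \<beta> (star c * star a) (star d * star b)) s) t"
      by (rule formal_eval_swap)
    also have "\<dots> = formal_eval \<beta> (?P (?S t) (?S s))"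
      unfolding formal_eval_map formal_eval_prod ..
    finally show "formal_eval \<beta> (?S (?P s t)) = formal_eval \<beta> (?P (?S t) (?S s))" .
  qed
  obtain f :: "'a \<Rightarrow> complex" where f: "clinear f" "f 1 = 1"
    using exists_separating_functional[of "1 :: 'a"] by auto
  obtain g :: "'b \<Rightarrow> complex" where g: "clinear g" "g 1 = 1"
    using exists_separating_functional[of "1 :: 'b"] by auto
  have "cbilinear (\<lambda>a b. f a * g b)"
    using f g by (simp add: cbilinear_iff clinear_iff scaleC_complex_def algebra_simps)
  moreover have "f 1 * g 1 \<noteq> 0" using f g by simp
  ultimately show "(0 :: ('a, 'b) tensor) \<noteq> 1"
    by transfer (force simp: tensor_eq_def)
qed

end

lemma one_tensor_elem: "1 = 1 \<otimes>\<^sub>C 1"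
  by transfer (simp add: tensor_eq_def)

lemma times_tensor_elem: "(a \<otimes>\<^sub>C b) * (c \<otimes>\<^sub>C d) = (a * c) \<otimes>\<^sub>C (b * d)"
  by transfer (simp add: tensor_eq_def)

lemma star_tensor_elem: "star (a \<otimes>\<^sub>C b) = star a \<otimes>\<^sub>C star b"
  by transfer (simp add: tensor_eq_def)

section \<open>Finite quantum groups\<close>

text \<open>
  The two density conditions on spans are equalities, because subspaces of a
  finite-dimensional space are closed.
\<close>

definition finite_quantum_group :: "('a::cstar_algebra \<Rightarrow> ('a, 'a) tensor) \<Rightarrow> bool" where
  "finite_quantum_group \<Delta> \<longleftrightarrow>
     (\<exists>B :: 'a set. finite B \<and> cspan B = UNIV) \<and>
     unital_star_hom \<Delta> \<and>
     tensor_map id \<Delta> \<circ> \<Delta> = tensor_assoc \<circ> tensor_map \<Delta> id \<circ> \<Delta> \<and>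
     cspan {\<Delta> b * (1 \<otimes>\<^sub>C a) | a b. True} = UNIV \<and>
     cspan {\<Delta> b * (a \<otimes>\<^sub>C 1) | a b. True} = UNIV"

definition state :: "('a::cstar_algebra \<Rightarrow> complex) \<Rightarrow> bool" where
  "state \<phi> \<longleftrightarrow> clinear \<phi> \<and> (\<forall>a. \<phi> (star a * a) \<in> \<real>\<^sub>\<ge>\<^sub>0) \<and> \<phi> 1 = 1"

text \<open>\<open>\<psi>\<^sub>1 \<otimes> \<psi>\<^sub>2\<close> is read as a functional via \<open>\<complex> \<otimes> \<complex> = \<complex>\<close>.\<close>

definition convolution :: "('a::cstar_algebra \<Rightarrow> ('a, 'a) tensor) \<Rightarrow>
    ('a \<Rightarrow> complex) \<Rightarrow> ('a \<Rightarrow> complex) \<Rightarrow> ('a \<Rightarrow> complex)" where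
  "convolution \<Delta> \<psi>\<^sub>1 \<psi>\<^sub>2 = tensor_lift (\<lambda>a b. \<psi>\<^sub>1 a * \<psi>\<^sub>2 b) \<circ> \<Delta>"

definition idempotent_state ::
    "('a::cstar_algebra \<Rightarrow> ('a, 'a) tensor) \<Rightarrow> ('a \<Rightarrow> complex) \<Rightarrow> bool" where
  "idempotent_state \<Delta> \<phi> \<longleftrightarrow> state \<phi> \<and> convolution \<Delta> \<phi> \<phi> = \<phi>"

definition right_coidalgebra ::
    "('a::cstar_algebra \<Rightarrow> ('a, 'a) tensor) \<Rightarrow> 'a set \<Rightarrow> bool" where
  "right_coidalgebra \<Delta> C \<longleftrightarrow>
     csubspace C \<and> 1 \<in> C \<and> (\<forall>x\<in>C. \<forall>y\<in>C. x * y \<in> C) \<and> (\<forall>x\<in>C. star x \<in> C) \<and>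
     \<Delta> ` C \<subseteq> cspan {a \<otimes>\<^sub>C c | a c. c \<in> C}"

definition idempotent_states ::
    "('a::cstar_algebra \<Rightarrow> ('a, 'a) tensor) \<Rightarrow> ('a \<Rightarrow> complex) gorder" where
  "idempotent_states \<Delta> =
     \<lparr>carrier = {\<phi>. idempotent_state \<Delta> \<phi>}, eq = (=),
      le = (\<lambda>\<phi>\<^sub>1 \<phi>\<^sub>2. convolution \<Delta> \<phi>\<^sub>1 \<phi>\<^sub>2 = \<phi>\<^sub>2)\<rparr>"

definition right_coidalgebras ::
    "('a::cstar_algebra \<Rightarrow> ('a, 'a) tensor) \<Rightarrow> 'a set gorder" where
  "right_coidalgebras \<Delta> =
     \<lparr>carrier = {C. right_coidalgebra \<Delta> C}, eq = (=), le = (\<subseteq>)\<rparr>"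

text \<open>\<open>join_pres\<close> and \<open>meet_pres\<close> include that both sides are lattices.\<close>

definition lattice_isomorphic :: "'a gorder \<Rightarrow> 'b gorder \<Rightarrow> bool" where
  "lattice_isomorphic L M \<longleftrightarrow>
     (\<exists>f. bij_betw f (carrier L) (carrier M) \<and> join_pres L M f \<and> meet_pres L M f)"

text \<open>
  An idempotent state \<open>\<phi>\<close> corresponds to the coidalgebra \<open>(id \<otimes> \<phi>)(\<Delta>(A))\<close>: the counit, the
  least idempotent state, to \<open>A\<close>, and the Haar state, the greatest one, to \<open>\<complex>1\<close>. The lattice of
  coidalgebras that is isomorphic to the idempotent states is therefore ordered by reverse
  inclusion, \<open>inv_gorder (right_coidalgebras \<Delta>)\<close>. With inclusion itself the two need not be
  isomorphic: for the functions on the alternating group on four letters they are the subgroup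
  lattice and its dual, and this subgroup lattice is not self-dual.
\<close>

end

theory Submission
  imports Defs "HOL-Computational_Algebra.Fundamental_Theorem_Algebra"
begin

text \<open>
  The trace \<open>\<tau>\<close> of the regular representation is a faithful positive functional, and the Galois
  map \<open>a \<otimes> b \<mapsto> \<Delta>(b)(a \<otimes> 1)\<close> intertwines left multiplication by \<open>1 \<otimes> x\<close> with left multiplication
  by \<open>\<Delta>(x)\<close>, so \<open>\<tau> \<star> \<tau> = \<tau>(1) \<tau>\<close>. Hence the normalized trace \<open>h\<close> is a faithful idempotent state,
  and any such state is the Haar state. An idempotent state \<open>\<phi>\<close> is sent to the range of
  \<open>(id \<otimes> \<phi>)\<Delta>\<close>, which is the \<open>h\<close>-orthogonal projection onto its range; the range is an algebra
  because it consists of the fixed points of a completely positive map that preserves the faithful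
  state \<open>h\<close>. Conversely, the \<open>h\<close>-orthogonal projection \<open>E\<close> onto a coidalgebra \<open>C\<close> satisfies
  \<open>\<Delta>E = (id \<otimes> E)\<Delta>\<close>, hence has the form \<open>(id \<otimes> \<phi>)\<Delta>\<close>, and \<open>\<phi>\<close> is positive because
  \<open>\<phi>(a) = h(pa)\<close> for a positive multiple \<open>p \<in> C\<close> of a projection.
\<close>

section \<open>Finite-dimensional complex vector spaces\<close>

text \<open>The axioms provide no counit, antipode or invariant state. Besides coassociativity they
  say that two Galois maps are surjective, and finite dimension makes these bijective; everything
  else is extracted from that. In particular an element with \<Delta>(x) = x \<otimes> 1 or
  \<Delta>(x) = 1 \<otimes> x has to be a scalar, which identifies the Haar state and also produces
  the functional behind a covariant map. The order is reversed because translation turns convolution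
  into composition: \<phi> \<star> \<psi> = \<psi> says that the projection of \<phi> fixes the
  range of the projection of \<psi>. Positivity is the obstacle on the way back from C, since E does
  not visibly come from a positive functional. The functional \<phi> satisfies \<phi>(cy) =
  \<phi>(c)\<phi>(y) for c in C, so it restricts to a character of C, and p is its density with
  respect to h. Multiplicativity forces p p = \<phi>(p) p, which is why p is a multiple of a
  projection. Traciality of h, inherited from the regular trace, then distributes p to both sides of
  a positive element.\<close>

lemma clinear_sum: "clinear f \<Longrightarrow> f (sum g A) = (\<Sum>x\<in>A. f (g x))"
  by (induction A rule: infinite_finite_induct) (auto simp: clinear_zero clinear_iff)

lemma clinear_compose: "clinear f \<Longrightarrow> clinear g \<Longrightarrow> clinear (\<lambda>x. f (g x))"
  by (simp add: clinear_iff)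

lemma finite_dimensional_scaleC:
  fixes S :: "'a::complex_vector set"
  assumes "finite S" "cspan S = UNIV"
  obtains B :: "'a set" where "finite_dimensional_vector_space scaleC B"
proof -
  obtain B where B: "B \<subseteq> S" "\<not> cvs.dependent B" "S \<subseteq> cspan B"
    using cvs.maximal_independent_subset by blast
  have "cspan B = UNIV"
    using B(3) assms(2) cvs.span_mono cvs.span_span by (metis top.extremum_uniqueI)
  then have "finite_dimensional_vector_space scaleC B"
    using B assms finite_subset by unfold_locales blast+
  then show ?thesis by (rule that)
qed

lemma clinear_surj_imp_inj:
  fixes f :: "'a::complex_vector \<Rightarrow> 'a"
  assumes "finite S" "cspan S = (UNIV :: 'a set)" "clinear f" "surj f"
  shows "inj f"
proof -
  obtain B :: "'a set" where "finite_dimensional_vector_space scaleC B"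
    using finite_dimensional_scaleC assms(1,2) by blast
  then interpret finite_dimensional_vector_space "scaleC :: complex \<Rightarrow> 'a \<Rightarrow> 'a" B .
  show ?thesis using assms(3,4) by (rule linear_surj_imp_inj)
qed

text \<open>An injective map preserves dimension, so the image cannot be a proper subspace of W.
  This makes the Galois map surjective on A \<otimes> C, about which the density axioms say nothing
  directly.\<close>

lemma clinear_inj_image_subspace:
  fixes f :: "'a::complex_vector \<Rightarrow> 'a"
  assumes "finite S" "cspan S = (UNIV :: 'a set)" "clinear f" "inj f" "csubspace W" "f ` W \<subseteq> W"
  shows "f ` W = W"
proof -
  obtain B :: "'a set" where "finite_dimensional_vector_space scaleC B"
    using finite_dimensional_scaleC assms(1,2) by blast
  then interpret finite_dimensional_vector_space "scaleC :: complex \<Rightarrow> 'a \<Rightarrow> 'a" B .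
  interpret finite_dimensional_vector_space_pair_1 "scaleC :: complex \<Rightarrow> 'a \<Rightarrow> 'a" B
    "scaleC :: complex \<Rightarrow> 'a \<Rightarrow> 'a" ..
  have "cvs.dim (f ` W) = cvs.dim W"
    using assms(3,4) by (intro dim_image_eq) (auto intro: inj_on_subset)
  moreover have "csubspace (f ` W)"
    using assms(3,5) by (auto simp: linear_iff_module_hom[symmetric] intro: linear_subspace_image)
  ultimately show ?thesis
    using subspace_dim_equal assms(5,6) by (metis order_refl)
qed

lemma clinear_eq_on_span:
  assumes "clinear f" "clinear g" "\<And>x. x \<in> G \<Longrightarrow> f x = g x" "x \<in> cspan G"
  shows "f x = g x"
proof -
  have "csubspace {x. f x = g x}"
    using assms(1,2) clinear_zero[OF assms(1)] clinear_zero[OF assms(2)]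
    by (simp add: cvs.subspace_def clinear_iff)
  from cvs.span_minimal[OF _ this] assms(3,4) show ?thesis by blast
qed

lemma clinear_sum_fun:
  "(\<And>i. i \<in> I \<Longrightarrow> clinear (f i)) \<Longrightarrow> clinear (\<lambda>x. \<Sum>i\<in>I. f i x)"
  by (simp add: clinear_iff sum.distrib cvs.scale_sum_right)

lemma clinear_inv:
  assumes "clinear f" "bij f"
  shows "clinear (inv f)"
proof -
  have inv: "f (inv f x) = x" "inv f (f y) = y" for x y
    using assms(2) by (simp_all add: bij_is_surj surj_f_inv_f bij_is_inj inv_f_f)
  have "inv f (x + y) = inv f (f (inv f x + inv f y))" "inv f (c *\<^sub>C x) = inv f (f (c *\<^sub>C inv f x))" for x y c
    using assms(1) by (simp_all add: clinear_iff inv)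
  then show ?thesis unfolding clinear_iff inv by blast
qed

section \<open>Frames, and traces of linear maps computed from them\<close>

definition frame ::
    "'i set \<Rightarrow> ('i \<Rightarrow> 'a::complex_vector) \<Rightarrow> ('i \<Rightarrow> 'a \<Rightarrow> complex) \<Rightarrow> bool" where
  "frame I e \<phi> \<longleftrightarrow> finite I \<and> (\<forall>i\<in>I. clinear (\<phi> i)) \<and> (\<forall>x. (\<Sum>i\<in>I. \<phi> i x *\<^sub>C e i) = x)"

definition frame_trace ::
    "'i set \<Rightarrow> ('i \<Rightarrow> 'a) \<Rightarrow> ('i \<Rightarrow> 'a \<Rightarrow> complex) \<Rightarrow> ('a \<Rightarrow> 'a) \<Rightarrow> complex" where
  "frame_trace I e \<phi> f = (\<Sum>i\<in>I. \<phi> i (f (e i)))"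

text \<open>Expanding \<open>f\<close> in the second frame and resumming \<open>g\<close> over the
  first gives tr(fg) = tr(gf) for maps between two spaces. With \<open>g = id\<close> this compares
  two frames of one space; with \<open>f\<close> bijective it gives invariance under
  conjugation.\<close>

lemma frame_trace_commute:
  assumes "frame I e \<phi>" "frame J d \<psi>" "clinear f" "clinear g"
  shows "frame_trace I e \<phi> (\<lambda>x. f (g x)) = frame_trace J d \<psi> (\<lambda>y. g (f y))"
proof -
  have expand: "\<phi> i (f y) = (\<Sum>j\<in>J. \<psi> j y * \<phi> i (f (d j)))" if "i \<in> I" for i y
  proof -
    have c: "clinear (\<lambda>x. \<phi> i (f x))" using assms that by (auto simp: frame_def clinear_compose)
    then have "\<phi> i (f (\<Sum>j\<in>J. \<psi> j y *\<^sub>C d j)) = (\<Sum>j\<in>J. \<psi> j y * \<phi> i (f (d j)))"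
      unfolding clinear_sum[OF c] by (simp add: clinear_iff scaleC_complex_def)
    then show ?thesis using assms by (simp add: frame_def)
  qed
  have contract: "(\<Sum>i\<in>I. \<psi> j (g (e i)) * \<phi> i z) = \<psi> j (g z)" if "j \<in> J" for j z
  proof -
    have c: "clinear (\<lambda>x. \<psi> j (g x))" using assms that by (auto simp: frame_def clinear_compose)
    then have "\<psi> j (g (\<Sum>i\<in>I. \<phi> i z *\<^sub>C e i)) = (\<Sum>i\<in>I. \<psi> j (g (e i)) * \<phi> i z)"
      unfolding clinear_sum[OF c] by (simp add: clinear_iff scaleC_complex_def mult.commute)
    then show ?thesis using assms by (simp add: frame_def)
  qed
  have "frame_trace I e \<phi> (\<lambda>x. f (g x)) =
      (\<Sum>i\<in>I. \<Sum>j\<in>J. \<psi> j (g (e i)) * \<phi> i (f (d j)))"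
    unfolding frame_trace_def by (intro sum.cong refl expand)
  also have "\<dots> = (\<Sum>j\<in>J. \<Sum>i\<in>I. \<psi> j (g (e i)) * \<phi> i (f (d j)))"
    by (rule sum.swap)
  also have "\<dots> = frame_trace J d \<psi> (\<lambda>y. g (f y))"
    unfolding frame_trace_def by (intro sum.cong refl contract)
  finally show ?thesis .
qed

lemma frame_trace_unique:
  assumes "frame I e \<phi>" "frame J d \<psi>" "clinear f"
  shows "frame_trace I e \<phi> f = frame_trace J d \<psi> f"
  using frame_trace_commute[OF assms, of id] by (simp add: clinear_iff)

lemma frame_of_basis:
  assumes "finite B" "\<not> cvs.dependent B" "cspan B = UNIV"
  shows "frame B id (\<lambda>b x. cvs.representation B x b)"
  using assms
  by (simp add: frame_def clinear_iff cvs.representation_add cvs.representation_scale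
      cvs.sum_representation_eq scaleC_complex_def)

lemma frame_exists:
  fixes S :: "'a::complex_vector set"
  assumes "finite S" "cspan S = UNIV"
  obtains I :: "'a set" and e :: "'a \<Rightarrow> 'a" and \<phi> :: "'a \<Rightarrow> 'a \<Rightarrow> complex" where "frame I e \<phi>"
proof -
  obtain B :: "'a set" where "finite_dimensional_vector_space scaleC B"
    using finite_dimensional_scaleC assms by blast
  then interpret finite_dimensional_vector_space "scaleC :: complex \<Rightarrow> 'a \<Rightarrow> 'a" B .
  show ?thesis
    using frame_of_basis[OF finite_Basis independent_Basis span_Basis] by (rule that)
qed

section \<open>Tensors\<close>

lemma scaleC_complex [simp]: "(c::complex) *\<^sub>C z = c * z"
  by (rule scaleC_complex_def)

text \<open>Scalars are absorbed into the first factor and zero is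
  \<open>0 \<otimes>\<^sub>C 0\<close>, so sums of elementary tensors exhaust the tensor product and
  no scalar or zero case arises.\<close>

lemma tensor_induct [case_names elem add]:
  assumes "\<And>a b. P (a \<otimes>\<^sub>C b)" "\<And>x y. P x \<Longrightarrow> P y \<Longrightarrow> P (x + y)"
  shows "P (t :: ('a::complex_vector, 'b::complex_vector) tensor)"
proof -
  have 0: "0 \<otimes>\<^sub>C 0 = (0 :: ('a, 'b) tensor)"
    using cbilinear_tensor_elem clinear_zero unfolding cbilinear_def by blast
  obtain s where "t = formal_eval (\<otimes>\<^sub>C) s"
    by (metis Quotient3_abs_rep[OF Quotient3_tensor] abs_tensor_eq)
  moreover have "P (formal_eval (\<otimes>\<^sub>C) s)"
  proof (induction s)
    case Nil
    then show ?case using assms(1)[of 0 0] 0 by simp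
  next
    case (Cons p s)
    then show ?case by (cases p) (simp add: assms)
  qed
  ultimately show ?thesis by simp
qed

lemma tensor_elem_simps:
  "(a + a') \<otimes>\<^sub>C b = a \<otimes>\<^sub>C b + a' \<otimes>\<^sub>C b" "a \<otimes>\<^sub>C (b + b') = a \<otimes>\<^sub>C b + a \<otimes>\<^sub>C b'"
  "(c *\<^sub>C a) \<otimes>\<^sub>C b = c *\<^sub>C (a \<otimes>\<^sub>C b)" "a \<otimes>\<^sub>C (c *\<^sub>C b) = c *\<^sub>C (a \<otimes>\<^sub>C b)"
  by (simp_all add: cbilinear_tensor_elem[unfolded cbilinear_iff])

lemma clinear_tensor_elem: "clinear (\<lambda>b. a \<otimes>\<^sub>C b)" "clinear (\<lambda>a. a \<otimes>\<^sub>C b)"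
  by (simp_all add: clinear_iff tensor_elem_simps)

lemma tensor_elem_zero [simp]: "a \<otimes>\<^sub>C 0 = 0" "0 \<otimes>\<^sub>C b = 0"
  by (simp_all add: clinear_zero[OF clinear_tensor_elem(1)] clinear_zero[OF clinear_tensor_elem(2)])

text \<open>\<open>tensor_lift\<close> evaluates a fixed representative, so it is additive in the form without any
  bilinearity.\<close>

lemma tensor_lift_fun:
  "tensor_lift (\<lambda>a b. \<beta> a b + \<gamma> a b) t = tensor_lift \<beta> t + tensor_lift \<gamma> t"
  "tensor_lift (\<lambda>a b. c *\<^sub>C \<beta> a b) t = c *\<^sub>C tensor_lift \<beta> t"
  by (simp_all add: tensor_lift_def formal_eval_add formal_eval_scaleC)

lemma clinear_tensor_lift_out:
  "clinear f \<Longrightarrow> f (tensor_lift \<beta> t) = tensor_lift (\<lambda>a b. f (\<beta> a b)) t"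
  unfolding tensor_lift_def by (rule formal_eval_hom) (auto simp: clinear_zero clinear_iff)

lemma tensor_lift_add: "cbilinear \<beta> \<Longrightarrow> tensor_lift \<beta> (s + t) = tensor_lift \<beta> s + tensor_lift \<beta> t"
  and tensor_lift_scaleC: "cbilinear \<beta> \<Longrightarrow> tensor_lift \<beta> (c *\<^sub>C t) = c *\<^sub>C tensor_lift \<beta> t"
  using clinear_tensor_lift[of \<beta>] by (simp_all add: clinear_iff)

lemma clinear_eq_tensor:
  assumes "clinear f" "clinear g" "\<And>a b. f (a \<otimes>\<^sub>C b) = g (a \<otimes>\<^sub>C b)"
  shows "f t = g t"
  using tensor_ext[OF assms] by simp

lemma tensor_map_elem:
  assumes "clinear f" "clinear g"
  shows "tensor_map f g (a \<otimes>\<^sub>C b) = f a \<otimes>\<^sub>C g b"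
  unfolding tensor_map_def
  by (subst tensor_lift_elem) (use assms in \<open>auto simp: cbilinear_iff clinear_iff tensor_elem_simps\<close>)

lemma clinear_tensor_map:
  assumes "clinear f" "clinear g"
  shows "clinear (tensor_map f g)"
  unfolding tensor_map_def
  by (rule clinear_tensor_lift) (use assms in \<open>auto simp: cbilinear_iff clinear_iff tensor_elem_simps\<close>)

lemma tensor_lift_map:
  assumes "cbilinear \<beta>" "clinear f" "clinear g"
  shows "tensor_lift \<beta> (tensor_map f g t) = tensor_lift (\<lambda>a b. \<beta> (f a) (g b)) t"
  using assms unfolding tensor_map_def
  by (subst clinear_tensor_lift_out) (simp_all add: clinear_tensor_lift tensor_lift_elem)

definition ctrilinear ::
    "('a::complex_vector \<Rightarrow> 'b::complex_vector \<Rightarrow> 'c::complex_vector \<Rightarrow> 'd::complex_vector) \<Rightarrow> bool" where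
  "ctrilinear \<beta> \<longleftrightarrow> (\<forall>a. cbilinear (\<beta> a)) \<and> (\<forall>b. cbilinear (\<lambda>a c. \<beta> a b c)) \<and> (\<forall>c. cbilinear (\<lambda>a b. \<beta> a b c))"

lemma ctrilinear_lift:
  assumes "ctrilinear \<beta>"
  shows "cbilinear (\<lambda>a t. tensor_lift (\<beta> a) t)"
    and "cbilinear (\<lambda>t c. tensor_lift (\<lambda>a b. \<beta> a b c) t)"
proof -
  have l: "cbilinear (\<beta> a)" "cbilinear (\<lambda>a b. \<beta> a b c)" for a c
    using assms by (auto simp: ctrilinear_def)
  have s: "\<beta> (a + a') b c = \<beta> a b c + \<beta> a' b c" "\<beta> (k *\<^sub>C a) b c = k *\<^sub>C \<beta> a b c"
    "\<beta> a b (c + c') = \<beta> a b c + \<beta> a b c'" "\<beta> a b (k *\<^sub>C c) = k *\<^sub>C \<beta> a b c" for a a' b c c' k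
    using assms unfolding ctrilinear_def cbilinear_iff by blast+
  have "tensor_lift (\<beta> (a + a')) t = tensor_lift (\<beta> a) t + tensor_lift (\<beta> a') t"
    "tensor_lift (\<beta> (k *\<^sub>C a)) t = k *\<^sub>C tensor_lift (\<beta> a) t" for a a' k t
    unfolding tensor_lift_fun[symmetric] s[symmetric] by simp_all
  then show "cbilinear (\<lambda>a t. tensor_lift (\<beta> a) t)"
    unfolding cbilinear_iff by (simp add: tensor_lift_add tensor_lift_scaleC l)
  show "cbilinear (\<lambda>t c. tensor_lift (\<lambda>a b. \<beta> a b c) t)"
    unfolding cbilinear_iff by (simp add: tensor_lift_add tensor_lift_scaleC l s tensor_lift_fun)
qed

text \<open>Reassociation disappears once trilinear forms are evaluated in nested fashion; this is
  what lets coassociativity be used as in Sweedler notation.\<close>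

lemma tensor_lift_assoc:
  fixes \<beta> :: "'a::complex_vector \<Rightarrow> 'b::complex_vector \<Rightarrow> 'c::complex_vector \<Rightarrow> 'd::complex_vector"
  assumes "ctrilinear \<beta>"
  shows "tensor_lift (\<lambda>a t. tensor_lift (\<beta> a) t) (tensor_assoc t) =
    tensor_lift (\<lambda>t c. tensor_lift (\<lambda>a b. \<beta> a b c) t) t"
proof -
  have t: "ctrilinear (\<lambda>a b c. a \<otimes>\<^sub>C b \<otimes>\<^sub>C c)" (is "ctrilinear ?\<gamma>")
    by (auto simp: ctrilinear_def cbilinear_iff tensor_elem_simps)
  have l: "cbilinear (\<beta> a)" "cbilinear (\<lambda>a b. \<beta> a b c)" for a c
    using assms by (auto simp: ctrilinear_def)
  have b: "cbilinear (\<lambda>a b. a \<otimes>\<^sub>C b \<otimes>\<^sub>C c)" for c :: 'c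
    by (simp add: cbilinear_iff tensor_elem_simps)
  note m = ctrilinear_lift(1)[OF assms]
  have "tensor_lift (\<lambda>a t. tensor_lift (\<beta> a) t) (tensor_assoc t) =
    tensor_lift (\<lambda>t c. tensor_lift (\<lambda>a t. tensor_lift (\<beta> a) t) (tensor_lift (\<lambda>a b. ?\<gamma> a b c) t)) t"
    unfolding tensor_assoc_def using clinear_tensor_lift[OF m]
    by (simp add: clinear_tensor_lift_out)
  also have "\<dots> = tensor_lift (\<lambda>t c. tensor_lift (\<lambda>a b. \<beta> a b c) t) t"
  proof -
    have "tensor_lift (\<lambda>a t. tensor_lift (\<beta> a) t) (tensor_lift (\<lambda>a b. ?\<gamma> a b c) t) =
      tensor_lift (\<lambda>a b. \<beta> a b c) t" for c t
      using clinear_tensor_lift[OF m]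
      by (simp add: clinear_tensor_lift_out tensor_lift_elem m l)
    then show ?thesis by simp
  qed
  finally show ?thesis .
qed

text \<open>\<open>frame\<close> asks for reconstruction rather than independence, so it is enough
  to rebuild elementary tensors. The product frame computes the regular trace of the tensor
  square.\<close>

lemma frame_tensor:
  assumes "frame I e \<phi>" "frame J d \<psi>"
  shows "frame (I \<times> J) (\<lambda>(i, j). e i \<otimes>\<^sub>C d j) (\<lambda>(i, j). tensor_lift (\<lambda>a b. \<phi> i a * \<psi> j b))"
proof -
  have b: "cbilinear (\<lambda>a b. \<phi> i a * \<psi> j b)" if "i \<in> I" "j \<in> J" for i j
    using assms that by (auto simp: frame_def clinear_iff cbilinear_iff algebra_simps)
  have "(\<Sum>(i, j)\<in>I \<times> J. tensor_lift (\<lambda>a b. \<phi> i a * \<psi> j b) t *\<^sub>C (e i \<otimes>\<^sub>C d j)) = t" for t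
  proof (rule clinear_eq_tensor)
    show "clinear (\<lambda>t. \<Sum>(i, j)\<in>I \<times> J. tensor_lift (\<lambda>a b. \<phi> i a * \<psi> j b) t *\<^sub>C (e i \<otimes>\<^sub>C d j))"
      using b by (auto simp: clinear_iff tensor_lift_add tensor_lift_scaleC scaleC_add_left
          scaleC_scaleC cvs.scale_sum_right simp flip: sum.distrib intro!: sum.cong)
    show "clinear (\<lambda>t. t)" by (simp add: clinear_iff)
    fix a b
    have "a \<otimes>\<^sub>C b = (\<Sum>i\<in>I. \<phi> i a *\<^sub>C e i) \<otimes>\<^sub>C (\<Sum>j\<in>J. \<psi> j b *\<^sub>C d j)"
      using assms by (simp add: frame_def)
    also have "\<dots> = (\<Sum>i\<in>I. \<Sum>j\<in>J. (\<phi> i a * \<psi> j b) *\<^sub>C (e i \<otimes>\<^sub>C d j))"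
      by (simp only: clinear_sum[OF clinear_tensor_elem(2)])
        (simp add: clinear_sum[OF clinear_tensor_elem(1)] tensor_elem_simps scaleC_scaleC
          cvs.scale_sum_right mult.commute)
    also have "\<dots> = (\<Sum>(i, j)\<in>I \<times> J. tensor_lift (\<lambda>a b. \<phi> i a * \<psi> j b) (a \<otimes>\<^sub>C b) *\<^sub>C (e i \<otimes>\<^sub>C d j))"
      unfolding sum.cartesian_product using b by (intro sum.cong) (auto simp: tensor_lift_elem)
    finally show "(\<Sum>(i, j)\<in>I \<times> J. tensor_lift (\<lambda>a b. \<phi> i a * \<psi> j b) (a \<otimes>\<^sub>C b) *\<^sub>C (e i \<otimes>\<^sub>C d j)) =
        a \<otimes>\<^sub>C b" ..
  qed
  then show ?thesis
    using assms b by (auto simp: frame_def clinear_tensor_lift case_prod_unfold)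
qed

lemma frame_span:
  assumes "frame I e \<phi>"
  shows "finite (e ` I)" "cspan (e ` I) = UNIV"
proof -
  show "finite (e ` I)" using assms by (simp add: frame_def)
  have "(\<Sum>i\<in>I. \<phi> i x *\<^sub>C e i) \<in> cspan (e ` I)" for x
    by (intro cvs.span_sum cvs.span_scale cvs.span_base) auto
  then show "cspan (e ` I) = UNIV" using assms by (auto simp: frame_def)
qed

text \<open>Membership in A \<otimes> C is tested by slicing the first leg with functionals. In this
  form the condition visibly passes to intersections of subspaces C.\<close>

lemma tensor_subspace_iff:
  fixes t :: "('a::complex_vector, 'b::complex_vector) tensor" and e :: "'i \<Rightarrow> 'a"
  assumes fr: "frame I e \<phi>" and C: "csubspace C"
  shows "t \<in> cspan {a \<otimes>\<^sub>C c | a c. c \<in> C} \<longleftrightarrow>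
    (\<forall>f. clinear f \<longrightarrow> tensor_lift (\<lambda>a b. f a *\<^sub>C b) t \<in> C)" (is "_ \<in> cspan ?G \<longleftrightarrow> _")
proof safe
  fix f :: "'a \<Rightarrow> complex" assume f: "clinear f"
  then have b: "cbilinear (\<lambda>a (b::'b). f a *\<^sub>C b)"
    by (simp add: clinear_iff cbilinear_iff scaleC_add_left scaleC_add_right scaleC_scaleC
        mult.commute)
  assume "t \<in> cspan ?G"
  then show "tensor_lift (\<lambda>a b. f a *\<^sub>C b) t \<in> C"
  proof (induction rule: cvs.span_induct_alt)
    case base
    then show ?case
      using clinear_zero[OF clinear_tensor_lift[OF b]] C by (simp add: cvs.subspace_0)
  next
    case (step k x y)
    then show ?case
      using C by (auto simp: tensor_lift_add tensor_lift_scaleC tensor_lift_elem b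
          intro!: cvs.subspace_add cvs.subspace_scale)
  qed
next
  assume *: "\<forall>f. clinear f \<longrightarrow> tensor_lift (\<lambda>a b. f a *\<^sub>C b) t \<in> C"
  have b: "cbilinear (\<lambda>a (b::'b). \<phi> i a *\<^sub>C b)" if "i \<in> I" for i
    using fr that by (simp add: frame_def clinear_iff cbilinear_iff scaleC_add_left scaleC_add_right
        scaleC_scaleC mult.commute)
  \<comment> \<open>The coordinate functionals of the frame already rebuild t from its slices, all
    of which lie in C.\<close>
  have "t = (\<Sum>i\<in>I. e i \<otimes>\<^sub>C tensor_lift (\<lambda>a b. \<phi> i a *\<^sub>C b) t)"
  proof (rule clinear_eq_tensor[where f = "\<lambda>t. t"])
    show "clinear (\<lambda>t::('a, 'b) tensor. t)" by (simp add: clinear_iff)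
    show "clinear (\<lambda>t. \<Sum>i\<in>I. e i \<otimes>\<^sub>C tensor_lift (\<lambda>(a::'a) (b::'b). \<phi> i a *\<^sub>C b) t)"
      using b by (auto simp: clinear_iff tensor_lift_add tensor_lift_scaleC tensor_elem_simps
          cvs.scale_sum_right simp flip: sum.distrib intro!: sum.cong)
    fix a :: 'a and c :: 'b
    have "(\<Sum>i\<in>I. e i \<otimes>\<^sub>C tensor_lift (\<lambda>a b. \<phi> i a *\<^sub>C b) (a \<otimes>\<^sub>C c)) =
        (\<Sum>i\<in>I. \<phi> i a *\<^sub>C e i) \<otimes>\<^sub>C c"
      using b by (simp add: tensor_lift_elem tensor_elem_simps clinear_sum[OF clinear_tensor_elem(2)])
    then show "a \<otimes>\<^sub>C c = (\<Sum>i\<in>I. e i \<otimes>\<^sub>C tensor_lift (\<lambda>a b. \<phi> i a *\<^sub>C b) (a \<otimes>\<^sub>C c))"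
      using fr by (simp add: frame_def)
  qed
  also have "\<dots> \<in> cspan ?G"
    using fr * by (intro cvs.span_sum cvs.span_base) (auto simp: frame_def)
  finally show "t \<in> cspan ?G" .
qed

section \<open>Positive functionals on *-algebras\<close>

lemma star_zero [simp]: "star (0::'a::complex_star_algebra) = 0"
  using star_add[of "0::'a" 0] by simp

lemma star_one [simp]: "star (1::'a::complex_star_algebra) = 1"
  using star_mult[of "1::'a" "star 1"] by (simp add: star_star)

lemma star_minus: "star (- x) = - star (x::'a::complex_star_algebra)"
  using star_add[of x "- x"] by (simp add: eq_neg_iff_add_eq_0 add.commute)

lemma star_diff: "star (x - y) = star x - star (y::'a::complex_star_algebra)"
  using star_add[of x "- y"] by (simp add: star_minus)

definition positive_functional :: "('a::complex_star_algebra \<Rightarrow> complex) \<Rightarrow> bool" where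
  "positive_functional \<psi> \<longleftrightarrow> clinear \<psi> \<and> (\<forall>x. \<psi> (star x * x) \<in> \<real>\<^sub>\<ge>\<^sub>0)"

lemma positive_functional_expand:
  assumes "clinear \<psi>"
  shows "\<psi> (star (k *\<^sub>C x + y) * (k *\<^sub>C x + y)) =
    k * cnj k * \<psi> (star x * x) + cnj k * \<psi> (star x * y) + k * \<psi> (star y * x) + \<psi> (star y * y)"
  using assms
  by (simp add: clinear_iff star_add star_scaleC distrib_left distrib_right mult_scaleC_left
      mult_scaleC_right algebra_simps)

text \<open>Polarization against 1: the value at the square of k x + 1 is real, and the choices k =
  1 and k = \<i> compare the imaginary and the real parts of the two sides.\<close>

lemma positive_functional_star:
  assumes "positive_functional \<psi>"
  shows "\<psi> (star x) = cnj (\<psi> x)"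
proof -
  have \<psi>: "clinear \<psi>" "\<And>x. Im (\<psi> (star x * x)) = 0"
    using assms by (auto simp: positive_functional_def complex_nonneg_Reals_iff)
  have "Im (\<psi> (star (1 *\<^sub>C x + 1) * (1 *\<^sub>C x + 1))) = 0"
    "Im (\<psi> (star (\<i> *\<^sub>C x + 1) * (\<i> *\<^sub>C x + 1))) = 0"
    by (rule \<psi>(2))+
  then show ?thesis
    unfolding positive_functional_expand[OF \<psi>(1)]
    using \<psi>(2)[of 1] by (simp add: complex_eq_iff \<psi>(2))
qed

text \<open>The degenerate case of Cauchy--Schwarz: the quadratic term in k of the expansion at k t
  + \<open>star z\<close> vanishes, so a nonzero linear term could make the value negative.\<close>

lemma positive_functional_null:
  assumes \<psi>: "positive_functional \<psi>" and t: "\<psi> (star t * t) = 0"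
  shows "\<psi> (z * t) = 0"
proof (rule ccontr)
  assume nz: "\<psi> (z * t) \<noteq> 0"
  define q where "q = \<psi> (z * t)"
  \<comment> \<open>The multiplier k is chosen so that k q = -r. The value at k t +
    \<open>star z\<close> then has real part -2r + (r - 1) = -r - 1, which is negative.\<close>
  define r where "r = Re (\<psi> (z * star z)) + 1"
  define k where "k = - complex_of_real (r / (cmod q)\<^sup>2) * cnj q"
  have lin: "clinear \<psi>" using \<psi> by (simp add: positive_functional_def)
  have "\<psi> (star t * star z) = cnj q"
    using positive_functional_star[OF \<psi>, of "z * t"] by (simp add: star_mult q_def)
  then have "\<psi> (star (k *\<^sub>C t + star z) * (k *\<^sub>C t + star z)) = cnj k * cnj q + k * q + \<psi> (z * star z)"
    unfolding positive_functional_expand[OF lin] by (simp add: t star_star q_def)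
  moreover have "k * q = - complex_of_real r"
  proof -
    have "cnj q * q = complex_of_real ((cmod q)\<^sup>2)"
      unfolding complex_norm_square by (rule mult.commute)
    then have "k * q = - complex_of_real (r / (cmod q)\<^sup>2) * complex_of_real ((cmod q)\<^sup>2)"
      by (simp add: k_def mult.assoc)
    then show ?thesis using nz by (simp add: q_def)
  qed
  then have "cnj k * cnj q = - complex_of_real r" "k * q = - complex_of_real r"
    by (simp_all add: complex_cnj_mult[symmetric] del: complex_cnj_mult)
  ultimately have "Re (\<psi> (star (k *\<^sub>C t + star z) * (k *\<^sub>C t + star z))) = - r - 1"
    by (simp add: r_def)
  moreover have "0 \<le> Re (\<psi> (star (k *\<^sub>C t + star z) * (k *\<^sub>C t + star z)))" "0 \<le> r"
    using \<psi> by (auto simp: positive_functional_def complex_nonneg_Reals_iff r_def star_star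
        dest: spec[of _ "star z"])
  ultimately show False by simp
qed

section \<open>The regular trace\<close>

text \<open>Left multiplication by a self-adjoint element of a finite-dimensional algebra is diagonalizable
  with real eigenvalues, so its square has nonnegative trace.\<close>

definition proper_involution :: "'a::complex_star_algebra itself \<Rightarrow> bool" where
  "proper_involution _ \<longleftrightarrow> (\<forall>x::'a. star x * x = 0 \<longrightarrow> x = 0)"

definition eigenvectors :: "'a::complex_star_algebra \<Rightarrow> 'a set" where
  "eigenvectors b = {y. \<exists>\<kappa>. b * y = \<kappa> *\<^sub>C y}"

text \<open>The element \<open>star y * y\<close> plays the part of a squared norm of y: moving b
  across it compares \<kappa> with its conjugate, and properness keeps it nonzero.\<close>

lemma selfadjoint_eigenvalue_real:
  fixes b :: "'a::complex_star_algebra"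
  assumes "proper_involution TYPE('a)" "star b = b" "b * y = \<kappa> *\<^sub>C y" "y \<noteq> 0"
  shows "\<kappa> \<in> \<real>"
proof -
  have "star y * (b * y) = \<kappa> *\<^sub>C (star y * y)"
    using assms(3) by (simp add: mult_scaleC_right)
  moreover from arg_cong[OF this, of star]
  have "star y * (b * y) = cnj \<kappa> *\<^sub>C (star y * y)"
    by (simp add: star_mult star_star star_scaleC assms(2) mult.assoc)
  ultimately have eq: "\<kappa> *\<^sub>C (star y * y) = cnj \<kappa> *\<^sub>C (star y * y)" by metis
  have "star y * y \<noteq> 0"
    using assms(1,4) unfolding proper_involution_def by blast
  from cvs.scale_right_imp_eq[OF this eq, symmetric] show ?thesis
    unfolding Reals_cnj_iff .
qed

text \<open>There is no Jordan block of length two: once \<kappa> is real, \<open>star v * v\<close>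
  equals \<open>star z\<close> times (b - \<kappa>) v, which vanishes.\<close>

lemma selfadjoint_generalized_eigenvector:
  fixes b :: "'a::complex_star_algebra"
  assumes p: "proper_involution TYPE('a)" and b: "star b = b"
    and v: "v = b * z - \<kappa> *\<^sub>C z" "b * v = \<kappa> *\<^sub>C v"
  shows "v = 0"
proof (rule ccontr)
  assume "v \<noteq> 0"
  then have "cnj \<kappa> = \<kappa>"
    using selfadjoint_eigenvalue_real[OF p b v(2)] by (simp add: Reals_cnj_iff)
  then have "star v * v = star z * (b * v - \<kappa> *\<^sub>C v)"
    using b by (subst v(1)) (simp add: star_diff star_mult star_scaleC left_diff_distrib
        right_diff_distrib mult_scaleC_left mult_scaleC_right mult.assoc)
  with v(2) have "star v * v = 0" by simp
  then show False using p \<open>v \<noteq> 0\<close> unfolding proper_involution_def by blast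
qed

text \<open>On an eigenvector with eigenvalue \<mu> different from \<kappa> the operator b -
  \<kappa> can be inverted. What remains is a \<kappa>-eigenvector in the image of b - \<kappa>, and
  such a vector is zero.\<close>

lemma span_eigenvectors_shift:
  fixes b :: "'a::complex_star_algebra"
  assumes p: "proper_involution TYPE('a)" and b: "star b = b"
    and z: "b * z - \<kappa> *\<^sub>C z \<in> cspan (eigenvectors b)"
  shows "z \<in> cspan (eigenvectors b)"
proof -
  have "\<exists>u\<in>cspan (eigenvectors b). \<exists>v. b * v = \<kappa> *\<^sub>C v \<and> w = b * u - \<kappa> *\<^sub>C u + v"
    if "w \<in> cspan (eigenvectors b)" for w
    using that
  proof (induction rule: cvs.span_induct_alt)
    case base
    show ?case by (intro bexI[of _ 0] exI[of _ 0]) (auto simp: cvs.span_zero)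
  next
    case (step k y w)
    then obtain u v \<mu> where uv: "u \<in> cspan (eigenvectors b)" "b * v = \<kappa> *\<^sub>C v"
      "w = b * u - \<kappa> *\<^sub>C u + v" and \<mu>: "b * y = \<mu> *\<^sub>C y"
      by (auto simp: eigenvectors_def)
    show ?case
    proof (cases "\<mu> = \<kappa>")
      case True
      then show ?thesis using uv \<mu>
        by (intro bexI[of _ u] exI[of _ "v + k *\<^sub>C y"])
          (auto simp: distrib_left mult_scaleC_right scaleC_add_right scaleC_scaleC mult.commute)
    next
      case False
      \<comment> \<open>Applying b - \<kappa> to y multiplies it by \<mu> - \<kappa>, hence this
        coefficient produces exactly k y.\<close>
      let ?u = "u + (k / (\<mu> - \<kappa>)) *\<^sub>C y"
      have "b * ?u - \<kappa> *\<^sub>C ?u = b * u - \<kappa> *\<^sub>C u + (k / (\<mu> - \<kappa>) * \<mu> - \<kappa> * (k / (\<mu> - \<kappa>))) *\<^sub>C y"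
        by (simp add: distrib_left mult_scaleC_right scaleC_add_right scaleC_scaleC \<mu>
            cvs.scale_left_diff_distrib)
      also have "k / (\<mu> - \<kappa>) * \<mu> - \<kappa> * (k / (\<mu> - \<kappa>)) = k / (\<mu> - \<kappa>) * (\<mu> - \<kappa>)"
        by (simp only: right_diff_distrib mult.commute[of \<kappa>])
      also have "\<dots> = k" using False by simp
      finally have "k *\<^sub>C y + w = b * ?u - \<kappa> *\<^sub>C ?u + v"
        using uv(3) by simp
      moreover have "?u \<in> cspan (eigenvectors b)"
        using \<mu> by (intro cvs.span_add uv(1) cvs.span_scale cvs.span_base) (auto simp: eigenvectors_def)
      ultimately show ?thesis using uv(2) by blast
    qed
  qed
  from this[OF z] obtain u v where u: "u \<in> cspan (eigenvectors b)" and v: "b * v = \<kappa> *\<^sub>C v"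
    and uv: "b * z - \<kappa> *\<^sub>C z = b * u - \<kappa> *\<^sub>C u + v" by blast
  have "v = b * (z - u) - \<kappa> *\<^sub>C (z - u)"
    using uv by (simp add: right_diff_distrib cvs.scale_right_diff_distrib algebra_simps)
  from this selfadjoint_generalized_eigenvector[OF p b this v]
  have "b * (z - u) = \<kappa> *\<^sub>C (z - u)" by simp
  then have "z - u \<in> cspan (eigenvectors b)"
    by (auto simp: eigenvectors_def intro: cvs.span_base)
  from cvs.span_add[OF this u] show ?thesis by simp
qed

section \<open>Polynomials in an algebra element, applied to a vector\<close>

definition poly_act :: "'a::complex_star_algebra \<Rightarrow> complex poly \<Rightarrow> 'a \<Rightarrow> 'a" where
  "poly_act b p z = (\<Sum>k\<le>degree p. coeff p k *\<^sub>C (b ^ k * z))"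

lemma poly_act_bound:
  "degree p \<le> n \<Longrightarrow> poly_act b p z = (\<Sum>k\<le>n. coeff p k *\<^sub>C (b ^ k * z))"
  unfolding poly_act_def by (rule sum.mono_neutral_left) (auto simp: coeff_eq_0)

lemma poly_act_add: "poly_act b (p + q) z = poly_act b p z + poly_act b q z"
proof -
  let ?n = "max (degree p) (degree q)"
  have "degree (p + q) \<le> ?n" by (rule degree_add_le_max)
  then show ?thesis
    by (simp add: poly_act_bound[of _ ?n] scaleC_add_left sum.distrib)
qed

lemma poly_act_smult: "poly_act b (smult c p) z = c *\<^sub>C poly_act b p z"
  by (simp add: poly_act_bound[of "smult c p" "degree p"] degree_smult_le poly_act_def
      scaleC_scaleC cvs.scale_sum_right)

lemma poly_act_shift: "poly_act b (pCons 0 p) z = b * poly_act b p z"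
proof -
  have "poly_act b (pCons 0 p) z = (\<Sum>k\<le>Suc (degree p). coeff (pCons 0 p) k *\<^sub>C (b ^ k * z))"
    by (intro poly_act_bound degree_pCons_le)
  also have "\<dots> = (\<Sum>k\<le>degree p. coeff p k *\<^sub>C (b ^ Suc k * z))"
    by (simp only: sum.atMost_Suc_shift coeff_pCons_0 coeff_pCons_Suc) simp
  also have "\<dots> = b * poly_act b p z"
    by (simp add: poly_act_def sum_distrib_left mult_scaleC_right mult.assoc)
  finally show ?thesis .
qed

lemma poly_act_const: "poly_act b [:c:] z = c *\<^sub>C z"
  by (simp add: poly_act_def)

lemma poly_act_monom: "poly_act b (monom c n) z = c *\<^sub>C (b ^ n * z)"
proof -
  have "poly_act b (monom c n) z = (\<Sum>k\<le>n. if k = n then c *\<^sub>C (b ^ k * z) else 0)"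
    unfolding poly_act_bound[OF degree_monom_le] by (intro sum.cong) auto
  then show ?thesis by simp
qed

text \<open>The vectors \<open>b ^ k * z\<close> cannot all be independent, so one of them is a
  combination of its predecessors. The polynomial is allowed to depend on z.\<close>

lemma annihilating_poly_exists:
  fixes b :: "'a::complex_star_algebra"
  assumes "finite S" "cspan S = (UNIV :: 'a set)"
  obtains p where "p \<noteq> 0" "poly_act b p z = 0"
proof -
  let ?v = "\<lambda>k. b ^ k * z"
  have "\<exists>n. ?v n \<in> cspan (?v ` {..<n})"
  proof (rule ccontr)
    assume *: "\<not> ?thesis"
    have "\<not> cvs.dependent (?v ` {..<n}) \<and> card (?v ` {..<n}) = n" for n
    proof (induction n)
      case (Suc n)
      have eq: "?v ` {..<Suc n} = insert (?v n) (?v ` {..<n})" by (simp only: lessThan_Suc image_insert)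
      have n: "?v n \<notin> cspan (?v ` {..<n})" using * by blast
      have "?v n \<notin> ?v ` {..<n}" by (rule contrapos_nn[OF n cvs.span_base])
      then have "card (insert (?v n) (?v ` {..<n})) = Suc n"
        using Suc by (subst card_insert_disjoint) auto
      then show ?case
        unfolding eq using cvs.independent_insertI[OF n] Suc by blast
    qed (simp add: cvs.independent_empty)
    from this[of "Suc (card S)"] cvs.independent_span_bound[OF assms(1), of "?v ` {..<Suc (card S)}"]
    show False by (simp only: assms(2)) simp
  qed
  then obtain n where n: "?v n \<in> cspan (?v ` {..<n})" by blast
  \<comment> \<open>The degree bound and the vanishing coefficient together say that only powers
    below m occur; unlike \<open>degree p < m\<close> they also admit the zero polynomial at m =
    0.\<close>
  have "\<exists>p. degree p < Suc m \<and> coeff p m = 0 \<and> w = poly_act b p z"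
    if "w \<in> cspan (?v ` {..<m})" for m w
    using that
  proof (induction m arbitrary: w)
    case 0
    then have "w = poly_act b 0 z" by (simp add: poly_act_def)
    then show ?case by (intro exI[of _ 0]) simp
  next
    case (Suc m)
    then have "w \<in> cspan (insert (?v m) (?v ` {..<m}))"
      by (simp only: lessThan_Suc image_insert)
    then obtain c where "w - c *\<^sub>C ?v m \<in> cspan (?v ` {..<m})"
      unfolding cvs.span_insert by blast
    then obtain p where p: "degree p < Suc m" "coeff p m = 0" "w - c *\<^sub>C ?v m = poly_act b p z"
      using Suc.IH by blast
    note m = poly_act_monom[of b c m z]
    have "degree (p + monom c m) < Suc (Suc m)"
      using p(1) degree_monom_le[of c m] by (intro le_imp_less_Suc degree_add_le) auto
    moreover have "coeff (p + monom c m) (Suc m) = 0"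
      using p(1) by (simp add: coeff_eq_0)
    moreover have "w = poly_act b (p + monom c m) z"
      using p(3) by (simp add: poly_act_add m algebra_simps)
    ultimately show ?case by blast
  qed
  from this[OF n] obtain p where p: "coeff p n = 0" "?v n = poly_act b p z" by blast
  \<comment> \<open>Subtracting the n-th power makes coefficient n equal to -1, so the relation is
    nontrivial.\<close>
  have m: "poly_act b (monom (-1) n) z = - ?v n"
    by (simp only: poly_act_monom cvs.scale_minus_left scaleC_one)
  have "coeff (p + monom (-1) n) n \<noteq> 0" using p(1) by simp
  then have "p + monom (-1) n \<noteq> 0" by (metis coeff_0)
  moreover have "poly_act b (p + monom (-1) n) z = 0"
    using p(2) by (simp add: poly_act_add m)
  ultimately show ?thesis by (rule that)
qed

text \<open>The fundamental theorem of algebra splits off a linear factor, and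
  \<open>span_eigenvectors_shift\<close> cancels its action; a nonzero constant remains at the
  end.\<close>

lemma span_eigenvectors_poly:
  fixes b :: "'a::complex_star_algebra"
  assumes "proper_involution TYPE('a)" "star b = b"
    and "p \<noteq> 0" "poly_act b p z \<in> cspan (eigenvectors b)"
  shows "z \<in> cspan (eigenvectors b)"
  using assms(3,4)
proof (induction "degree p" arbitrary: p)
  case 0
  then obtain c where "p = [:c:]" "c \<noteq> 0"
    by (metis degree_eq_zeroE pCons_0_0)
  then show ?case
    using 0 cvs.span_scale[of "c *\<^sub>C z" "eigenvectors b" "inverse c"]
    by (simp add: poly_act_const scaleC_scaleC scaleC_one)
next
  case (Suc n)
  then have "\<not> constant (poly p)" by (simp add: constant_degree)
  then obtain \<kappa> where "poly p \<kappa> = 0" using fundamental_theorem_of_algebra by blast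
  then obtain q where q: "p = [:- \<kappa>, 1:] * q" by (auto simp: poly_eq_0_iff_dvd dvd_def)
  with Suc have "q \<noteq> 0" by auto
  have "degree p = degree [:- \<kappa>, 1:] + degree q"
    unfolding q by (rule degree_mult_eq) (use \<open>q \<noteq> 0\<close> in auto)
  with Suc(2) have "n = degree q" by simp
  have "p = pCons 0 q + smult (- \<kappa>) q" by (simp add: q)
  then have "poly_act b p z = b * poly_act b q z - \<kappa> *\<^sub>C poly_act b q z"
    by (simp only: poly_act_add poly_act_shift poly_act_smult) simp
  with Suc span_eigenvectors_shift[OF assms(1,2)]
  have "poly_act b q z \<in> cspan (eigenvectors b)" by metis
  with Suc(1)[OF \<open>n = degree q\<close> \<open>q \<noteq> 0\<close>] show ?case .
qed

text \<open>A basis of eigenvectors turns the trace into the sum of the squares of the real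
  eigenvalues. If it vanishes, b kills a spanning set and therefore also 1.\<close>

lemma trace_selfadjoint_square:
  fixes b :: "'a::complex_star_algebra"
  assumes p: "proper_involution TYPE('a)" and b: "star b = b" and fr: "frame I e \<phi>"
  defines "t \<equiv> frame_trace I e \<phi> (\<lambda>x. b * b * x)"
  shows "t \<in> \<real>\<^sub>\<ge>\<^sub>0" "t = 0 \<Longrightarrow> b = 0"
proof -
  note S = frame_span[OF fr]
  have "z \<in> cspan (eigenvectors b)" for z
    using annihilating_poly_exists[OF S, of b z] span_eigenvectors_poly[OF p b]
    by (metis cvs.span_zero)
  then have sp: "cspan (eigenvectors b) = UNIV" by blast
  obtain B where B: "B \<subseteq> eigenvectors b" "\<not> cvs.dependent B" "eigenvectors b \<subseteq> cspan B"
    using cvs.maximal_independent_subset by blast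
  have spB: "cspan B = UNIV"
    using B(3) sp cvs.span_mono cvs.span_span by (metis top.extremum_uniqueI)
  have fB: "finite B"
    using cvs.independent_span_bound[OF S(1) B(2)] S(2) by simp
  have "\<forall>y\<in>B. \<exists>c. b * y = c *\<^sub>C y" using B(1) by (auto simp: eigenvectors_def)
  from bchoice[OF this] obtain \<kappa> where \<kappa>: "\<And>y. y \<in> B \<Longrightarrow> b * y = \<kappa> y *\<^sub>C y" by blast
  have "cvs.representation B (b * b * y) y = (\<kappa> y)\<^sup>2" if "y \<in> B" for y
  proof -
    have "b * b * y = (\<kappa> y)\<^sup>2 *\<^sub>C y"
      using \<kappa>[OF that] by (simp add: mult.assoc mult_scaleC_right scaleC_scaleC power2_eq_square)
    then show ?thesis
      using that spB by (simp add: cvs.representation_scale cvs.representation_basis B(2))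
  qed
  then have t: "t = (\<Sum>y\<in>B. (\<kappa> y)\<^sup>2)"
    unfolding t_def
    by (subst frame_trace_unique[OF fr frame_of_basis[OF fB B(2) spB]])
      (simp_all add: clinear_iff distrib_left mult_scaleC_right frame_trace_def)
  have "\<kappa> y \<in> \<real>" if "y \<in> B" for y
    using selfadjoint_eigenvalue_real[OF p b \<kappa>[OF that]] that B(2) cvs.dependent_zero by blast
  then have re: "(\<kappa> y)\<^sup>2 = complex_of_real ((Re (\<kappa> y))\<^sup>2)" if "y \<in> B" for y
    using that by (simp add: complex_is_Real_iff complex_eq_iff power2_eq_square)
  then have t': "t = complex_of_real (\<Sum>y\<in>B. (Re (\<kappa> y))\<^sup>2)"
    unfolding t by simp
  show "t \<in> \<real>\<^sub>\<ge>\<^sub>0"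
    unfolding t' by (simp add: sum_nonneg del: of_real_sum)
  assume "t = 0"
  then have "\<kappa> y = 0" if "y \<in> B" for y
    using re[OF that] that fB unfolding t' of_real_eq_0_iff
    by (subst (asm) sum_nonneg_eq_0_iff) auto
  with \<kappa> have "b * y = 0" if "y \<in> B" for y using that by simp
  then have "B \<subseteq> {y. b * y = 0}" by blast
  moreover have "csubspace {y. b * y = 0}"
    by (auto simp: cvs.subspace_def distrib_left mult_scaleC_right)
  ultimately have "cspan B \<subseteq> {y. b * y = 0}" by (rule cvs.span_minimal)
  with spB have "b * 1 = 0" by blast
  then show "b = 0" by simp
qed

definition faithful_functional :: "('a::complex_star_algebra \<Rightarrow> complex) \<Rightarrow> bool" where
  "faithful_functional \<psi> \<longleftrightarrow> positive_functional \<psi> \<and> (\<forall>x. \<psi> (star x * x) = 0 \<longrightarrow> x = 0)"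

lemma regular_trace_faithful:
  fixes \<phi> :: "'i \<Rightarrow> 'a::complex_star_algebra \<Rightarrow> complex"
  assumes p: "proper_involution TYPE('a)" and fr: "frame I e \<phi>"
  defines "\<tau> \<equiv> \<lambda>a. frame_trace I e \<phi> (\<lambda>x. a * x)"
  shows "\<tau> (a * b) = \<tau> (b * a)" "faithful_functional \<tau>"
proof -
  have lin: "clinear \<tau>"
    using fr unfolding \<tau>_def frame_trace_def frame_def
    by (auto simp: clinear_iff distrib_right mult_scaleC_left sum_distrib_left
        simp flip: sum.distrib)
  have assoc: "(\<lambda>x. a * b * x) = (\<lambda>x. a * (b * x))" for a b :: 'a
    by (simp add: fun_eq_iff mult.assoc)
  have commute: "\<tau> (a * b) = \<tau> (b * a)" for a b
    using frame_trace_commute[OF fr fr, of "(*) a" "(*) b"]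
    by (simp add: \<tau>_def assoc clinear_iff distrib_left mult_scaleC_right)
  then show "\<tau> (a * b) = \<tau> (b * a)" .
  have "\<tau> (star a * a) \<in> \<real>\<^sub>\<ge>\<^sub>0 \<and> (\<tau> (star a * a) = 0 \<longrightarrow> a = 0)" for a
  proof -
    \<comment> \<open>Real and imaginary part of a up to real factors. Since s s + k k = 2 (a
      \<open>star a\<close> + \<open>star a\<close> a), the trace property expresses
      \<tau>(\<open>star a * a\<close>) through the traces of two self-adjoint squares.\<close>
    define s k where "s = a + star a" and "k = \<i> *\<^sub>C (a - star a)"
    have sa: "star s = s" "star k = k"
      by (simp_all add: s_def k_def star_add star_diff star_scaleC star_star add.commute
          cvs.scale_right_diff_distrib)
    have "s * s + k * k = 2 *\<^sub>C (a * star a + star a * a)"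
    proof -
      have "k * k = - ((a - star a) * (a - star a))"
        by (simp add: k_def mult_scaleC_left mult_scaleC_right scaleC_scaleC scaleC_one)
      then have "s * s + k * k = (a * star a + star a * a) + (a * star a + star a * a)"
        by (simp add: s_def algebra_simps)
      also have "\<dots> = (1 + 1) *\<^sub>C (a * star a + star a * a)"
        by (simp only: scaleC_add_left scaleC_one)
      finally show ?thesis by simp
    qed
    from arg_cong[OF this, of \<tau>] lin
    have "\<tau> (s * s) + \<tau> (k * k) = 2 * (\<tau> (a * star a) + \<tau> (star a * a))"
      by (simp add: clinear_iff)
    also have "\<dots> = 4 * \<tau> (star a * a)" using commute[of a "star a"] by simp
    finally have eq: "\<tau> (star a * a) = (\<tau> (s * s) + \<tau> (k * k)) / 4" by simp
    have nn: "\<tau> (s * s) \<in> \<real>\<^sub>\<ge>\<^sub>0" "\<tau> (k * k) \<in> \<real>\<^sub>\<ge>\<^sub>0"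
      unfolding \<tau>_def using sa by (auto intro: trace_selfadjoint_square(1)[OF p _ fr])
    have "s = 0 \<and> k = 0" if "\<tau> (star a * a) = 0"
    proof -
      have "\<tau> (s * s) = 0" "\<tau> (k * k) = 0"
        using that nn unfolding eq by (auto simp: complex_nonneg_Reals_iff complex_eq_iff)
      then show ?thesis
        unfolding \<tau>_def using trace_selfadjoint_square(2)[OF p _ fr] sa by blast
    qed
    moreover have "a = 0" if "s = 0" "k = 0"
    proof -
      have "a - star a = 0" using that(2) by (simp add: k_def)
      then have "a + a = 0"
        using that(1) by (simp add: s_def)
      then have "(1 + 1) *\<^sub>C a = 0"
        by (simp only: scaleC_add_left scaleC_one)
      then show ?thesis by simp
    qed
    ultimately show ?thesis
      using nn unfolding eq by (auto simp: complex_nonneg_Reals_iff)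
  qed
  then show "faithful_functional \<tau>"
    using lin by (simp add: faithful_functional_def positive_functional_def)
qed

text \<open>The C*-identity enters the argument through this algebraic consequence.\<close>

lemma cstar_proper_involution: "proper_involution TYPE('a::cstar_algebra)"
  unfolding proper_involution_def
  by (metis norm_star_mult norm_eq_zero power2_eq_square mult_eq_0_iff norm_zero)

section \<open>Orthogonal projections and product functionals\<close>

lemma positive_functional_clinear: "positive_functional \<psi> \<Longrightarrow> clinear \<psi>"
  and faithful_functional_positive: "faithful_functional \<psi> \<Longrightarrow> positive_functional \<psi>"
  by (simp_all add: positive_functional_def faithful_functional_def)

lemma faithful_nondegenerate:
  assumes "faithful_functional h" "\<And>x. h (x * y) = 0"
  shows "y = 0"
  using assms unfolding faithful_functional_def by blast

text \<open>The equality case of Cauchy--Schwarz: q is real, so the four terms of the expansion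
  cancel. It serves to compare \<Delta>(x) with x \<otimes> 1 or 1 \<otimes> x.\<close>

lemma positive_functional_diff_null:
  assumes \<psi>: "positive_functional \<psi>"
    and "\<psi> (star u * u) = q" "\<psi> (star v * v) = q" "\<psi> (star v * u) = q"
  shows "\<psi> (star (u - v) * (u - v)) = 0"
proof -
  note lin = positive_functional_clinear[OF \<psi>]
  have "q \<in> \<real>\<^sub>\<ge>\<^sub>0" using \<psi> assms(2) by (auto simp: positive_functional_def)
  then have "cnj q = q" by (simp add: complex_nonneg_Reals_iff complex_eq_iff)
  then have "\<psi> (star u * v) = q"
    using positive_functional_star[OF \<psi>, of "star v * u"] assms(4) by (simp add: star_mult star_star)
  then show ?thesis
    using assms by (simp add: star_diff left_diff_distrib right_diff_distrib clinear_diff[OF lin])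
qed

text \<open>The vectors are nonzero but not normalized: dividing by \<open>h (star e * e)\<close> in
  the projection avoids square roots.\<close>

definition orthogonal_set :: "('a::complex_star_algebra \<Rightarrow> complex) \<Rightarrow> 'a set \<Rightarrow> bool" where
  "orthogonal_set h S \<longleftrightarrow> finite S \<and> 0 \<notin> S \<and> (\<forall>x\<in>S. \<forall>y\<in>S. x \<noteq> y \<longrightarrow> h (star x * y) = 0)"

definition ortho_proj :: "('a::complex_star_algebra \<Rightarrow> complex) \<Rightarrow> 'a set \<Rightarrow> 'a \<Rightarrow> 'a" where
  "ortho_proj h S a = (\<Sum>e\<in>S. (h (star e * a) / h (star e * e)) *\<^sub>C e)"

lemma clinear_ortho_proj: "clinear h \<Longrightarrow> clinear (ortho_proj h S)"
  by (simp add: clinear_iff ortho_proj_def distrib_left mult_scaleC_right add_divide_distrib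
      scaleC_add_left sum.distrib cvs.scale_sum_right scaleC_scaleC)

lemma ortho_proj_in_span: "ortho_proj h S a \<in> cspan S"
  unfolding ortho_proj_def by (intro cvs.span_sum cvs.span_scale cvs.span_base)

lemma ortho_proj_orthogonal:
  assumes h: "faithful_functional h" and S: "orthogonal_set h S" and x: "x \<in> cspan S"
  shows "h (star x * (a - ortho_proj h S a)) = 0"
proof -
  have lin: "clinear h"
    using h by (simp add: faithful_functional_positive positive_functional_clinear)
  let ?d = "a - ortho_proj h S a"
  have "h (star x * ?d) = 0" if "x \<in> S" for x
  proof -
    have "h (star x * ortho_proj h S a) =
        (\<Sum>e\<in>S. h (star e * a) / h (star e * e) * h (star x * e))"
      using lin by (simp add: ortho_proj_def sum_distrib_left clinear_sum mult_scaleC_right)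
        (simp add: clinear_iff)
    also have "\<dots> = (\<Sum>e\<in>S. if e = x then h (star x * a) else 0)"
    proof (intro sum.cong refl)
      fix e assume "e \<in> S"
      then have "e \<noteq> 0" using S by (auto simp: orthogonal_set_def)
      then have "h (star e * e) \<noteq> 0" using h unfolding faithful_functional_def by blast
      then show "h (star e * a) / h (star e * e) * h (star x * e) = (if e = x then h (star x * a) else 0)"
        using S \<open>e \<in> S\<close> \<open>x \<in> S\<close> by (auto simp: orthogonal_set_def)
    qed
    also have "\<dots> = h (star x * a)"
      using S that by (simp add: orthogonal_set_def)
    finally show ?thesis by (simp add: right_diff_distrib clinear_diff[OF lin])
  qed
  then have "S \<subseteq> {x. h (star x * ?d) = 0}" by blast
  moreover have "csubspace {x. h (star x * ?d) = 0}"
    using lin clinear_zero[OF lin]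
    by (simp add: cvs.subspace_def star_add star_scaleC distrib_right mult_scaleC_left clinear_iff)
  ultimately have "cspan S \<subseteq> {x. h (star x * ?d) = 0}" by (rule cvs.span_minimal)
  with x show ?thesis by blast
qed

lemma ortho_proj_unique:
  assumes h: "faithful_functional h" and S: "orthogonal_set h S"
    and b: "b \<in> cspan S" "\<And>x. x \<in> cspan S \<Longrightarrow> h (star x * (a - b)) = 0"
  shows "ortho_proj h S a = b"
proof -
  have lin: "clinear h"
    using h by (simp add: faithful_functional_positive positive_functional_clinear)
  let ?d = "ortho_proj h S a - b"
  have "?d \<in> cspan S" by (intro cvs.span_diff ortho_proj_in_span b)
  from b(2)[OF this] ortho_proj_orthogonal[OF h S this, of a]
  have "h (star ?d * ((a - b) - (a - ortho_proj h S a))) = 0"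
    by (simp only: right_diff_distrib[of _ "a - b"] clinear_diff[OF lin]) simp
  then have "h (star ?d * ?d) = 0" by simp
  then have "?d = 0" using h unfolding faithful_functional_def by blast
  then show ?thesis by simp
qed

lemma ortho_proj_fixed:
  assumes "faithful_functional h" "orthogonal_set h S" "a \<in> cspan S"
  shows "ortho_proj h S a = a"
  using assms
  by (intro ortho_proj_unique)
    (auto simp: clinear_zero positive_functional_clinear faithful_functional_positive)

lemma gram_schmidt:
  assumes h: "faithful_functional h" and "finite S"
  shows "\<exists>S'. orthogonal_set h S' \<and> cspan S' = cspan S"
  using assms(2)
proof (induction S)
  case empty
  show ?case by (intro exI[of _ "{}"]) (simp add: orthogonal_set_def)
next
  case (insert a S)
  then obtain S' where S': "orthogonal_set h S'" "cspan S' = cspan S" by blast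
  have span: "cspan (insert a S') = cspan (insert a S)"
    using S'(2) by (simp add: cvs.span_insert)
  define e where "e = a - ortho_proj h S' a"
  show ?case
  proof (cases "e = 0")
    case True
    then have "a \<in> cspan S'" using ortho_proj_in_span[of h S' a] by (simp add: e_def)
    with span S'(1) show ?thesis by (metis cvs.span_redundant)
  next
    case False
    have orth: "h (star x * e) = 0" if "x \<in> S'" for x
      unfolding e_def by (rule ortho_proj_orthogonal[OF h S'(1) cvs.span_base[OF that]])
    have "h (star e * x) = 0" if "x \<in> S'" for x
      using positive_functional_star[OF faithful_functional_positive[OF h], of "star x * e"] orth[OF that]
      by (simp add: star_mult star_star)
    with orth S'(1) False have "orthogonal_set h (insert e S')"
      by (auto simp: orthogonal_set_def)
    moreover have "e - a \<in> cspan S'"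
      using cvs.span_neg[OF ortho_proj_in_span[of h S' a]] by (simp add: e_def)
    then have "cspan (insert e S') = cspan (insert a S')"
      by (rule cvs.eq_span_insert_eq)
    ultimately show ?thesis using span by blast
  qed
qed

lemma orthogonal_basis_exists:
  fixes W :: "'a::complex_star_algebra set"
  assumes h: "faithful_functional h" and S: "finite S" "cspan S = (UNIV :: 'a set)" and W: "csubspace W"
  obtains B where "orthogonal_set h B" "cspan B = W"
proof -
  obtain B where B: "B \<subseteq> W" "\<not> cvs.dependent B" "W \<subseteq> cspan B"
    using cvs.maximal_independent_subset by blast
  have "finite B"
    using cvs.independent_span_bound[OF S(1) B(2)] S(2) by simp
  moreover have "cspan B = W"
    using B(3) cvs.span_minimal[OF B(1) W] by blast
  ultimately show ?thesis using gram_schmidt[OF h] that by metis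
qed

section \<open>Product functionals on tensor products\<close>

definition product_functional ::
    "('a::complex_vector \<Rightarrow> complex) \<Rightarrow> ('b::complex_vector \<Rightarrow> complex) \<Rightarrow> ('a, 'b) tensor \<Rightarrow> complex" where
  "product_functional \<phi> \<psi> = tensor_lift (\<lambda>a b. \<phi> a * \<psi> b)"

lemma cbilinear_product: "clinear \<phi> \<Longrightarrow> clinear \<psi> \<Longrightarrow> cbilinear (\<lambda>a b. \<phi> a * \<psi> b :: complex)"
  by (simp add: clinear_iff cbilinear_iff algebra_simps)

lemma clinear_product_functional:
  "clinear \<phi> \<Longrightarrow> clinear \<psi> \<Longrightarrow> clinear (product_functional \<phi> \<psi>)"
  unfolding product_functional_def by (intro clinear_tensor_lift cbilinear_product)

lemma product_functional_elem:
  "clinear \<phi> \<Longrightarrow> clinear \<psi> \<Longrightarrow> product_functional \<phi> \<psi> (a \<otimes>\<^sub>C b) = \<phi> a * \<psi> b"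
  unfolding product_functional_def by (simp add: tensor_lift_elem cbilinear_product)

lemma tensor_expand:
  fixes t :: "('a::complex_star_algebra, 'b::complex_vector) tensor"
  assumes h: "faithful_functional h" and S: "orthogonal_set h S" "cspan S = (UNIV :: 'a set)"
  shows "\<exists>b. t = (\<Sum>e\<in>S. e \<otimes>\<^sub>C b e)"
proof (induction t rule: tensor_induct)
  case (elem a b)
  have "a \<otimes>\<^sub>C b = ortho_proj h S a \<otimes>\<^sub>C b"
    using S by (simp add: ortho_proj_fixed[OF h])
  also have "\<dots> = (\<Sum>e\<in>S. e \<otimes>\<^sub>C (h (star e * a) / h (star e * e)) *\<^sub>C b)"
    by (simp add: ortho_proj_def clinear_sum[OF clinear_tensor_elem(2)] tensor_elem_simps)
  finally show ?case by (rule exI[of _ "\<lambda>e. (h (star e * a) / h (star e * e)) *\<^sub>C b"])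
next
  case (add x y)
  then obtain b c where "x = (\<Sum>e\<in>S. e \<otimes>\<^sub>C b e)" "y = (\<Sum>e\<in>S. e \<otimes>\<^sub>C c e)" by blast
  then have "x + y = (\<Sum>e\<in>S. e \<otimes>\<^sub>C (b e + c e))"
    by (simp add: tensor_elem_simps sum.distrib)
  then show ?case by (rule exI[of _ "\<lambda>e. b e + c e"])
qed

text \<open>Orthogonality of the first legs removes the cross terms. What remains is a sum of
  products of values on squares, so positivity and faithfulness of h \<otimes> \<phi> can be read
  off termwise.\<close>

lemma product_functional_square:
  fixes h :: "'a::complex_star_algebra \<Rightarrow> complex" and \<phi> :: "'b::complex_star_algebra \<Rightarrow> complex"
  assumes h: "clinear h" and \<phi>: "clinear \<phi>" and S: "orthogonal_set h S"
    and t: "t = (\<Sum>e\<in>S. e \<otimes>\<^sub>C b e)"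
  shows "product_functional h \<phi> (star t * t) = (\<Sum>e\<in>S. h (star e * e) * \<phi> (star (b e) * b e))"
proof -
  note lin = clinear_product_functional[OF h \<phi>]
  have fin: "finite S" using S by (simp add: orthogonal_set_def)
  have "star t = (\<Sum>e\<in>S. star e \<otimes>\<^sub>C star (b e))"
    unfolding t using fin by (induction S) (auto simp: star_add star_tensor_elem)
  then have "product_functional h \<phi> (star t * t) =
      (\<Sum>e\<in>S. \<Sum>f\<in>S. h (star e * f) * \<phi> (star (b e) * b f))"
    unfolding t
    by (simp add: sum_product clinear_sum[OF lin] times_tensor_elem product_functional_elem h \<phi>)
  also have "\<dots> = (\<Sum>e\<in>S. \<Sum>f\<in>S. if f = e then h (star e * e) * \<phi> (star (b e) * b e) else 0)"
    using S by (intro sum.cong) (auto simp: orthogonal_set_def)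
  finally show ?thesis using fin by simp
qed

lemma product_functional_positive:
  fixes h :: "'a::complex_star_algebra \<Rightarrow> complex" and \<phi> :: "'b::complex_star_algebra \<Rightarrow> complex"
  assumes S: "finite S" "cspan S = (UNIV :: 'a set)"
    and h: "faithful_functional h" and \<phi>: "positive_functional \<phi>"
  shows "positive_functional (product_functional h \<phi>)"
    and "faithful_functional \<phi> \<Longrightarrow> faithful_functional (product_functional h \<phi>)"
proof -
  obtain B where B: "orthogonal_set h B" "cspan B = (UNIV :: 'a set)"
    using orthogonal_basis_exists[OF h S, of UNIV] by auto
  have lin: "clinear h" "clinear \<phi>"
    using h \<phi> by (simp_all add: faithful_functional_positive positive_functional_clinear)
  have nn: "h (star e * e) \<in> \<real>\<^sub>\<ge>\<^sub>0" "\<phi> (star x * x) \<in> \<real>\<^sub>\<ge>\<^sub>0" for e x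
    using h \<phi> by (auto simp: faithful_functional_def positive_functional_def)
  have nn': "h (star e * e) * \<phi> (star x * x) \<in> \<real>\<^sub>\<ge>\<^sub>0" for e x
    using nn by (rule nonneg_Reals_mult_I)
  have sq: "product_functional h \<phi> (star t * t) \<in> \<real>\<^sub>\<ge>\<^sub>0 \<and>
      (faithful_functional \<phi> \<longrightarrow> product_functional h \<phi> (star t * t) = 0 \<longrightarrow> t = 0)" for t
  proof -
    obtain b where t: "t = (\<Sum>e\<in>B. e \<otimes>\<^sub>C b e)" using tensor_expand[OF h B] by blast
    note eq = product_functional_square[OF lin B(1) t]
    define r where "r e = Re (h (star e * e) * \<phi> (star (b e) * b e))" for e
    have r: "h (star e * e) * \<phi> (star (b e) * b e) = complex_of_real (r e)" "0 \<le> r e" for e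
      using nn'[of e "b e"] unfolding r_def by (auto simp: complex_nonneg_Reals_iff complex_eq_iff)
    have eq': "product_functional h \<phi> (star t * t) = complex_of_real (\<Sum>e\<in>B. r e)"
      unfolding eq r by simp
    have "t = 0" if f: "faithful_functional \<phi>" and 0: "product_functional h \<phi> (star t * t) = 0"
    proof -
      have "r e = 0" if "e \<in> B" for e
        using 0 that r(2) B(1) unfolding eq' of_real_eq_0_iff
        by (subst (asm) sum_nonneg_eq_0_iff) (auto simp: orthogonal_set_def)
      then have "h (star e * e) * \<phi> (star (b e) * b e) = 0" if "e \<in> B" for e
        using r(1) that by simp
      then have "b e = 0" if "e \<in> B" for e
        using that h f B(1) unfolding faithful_functional_def orthogonal_set_def
        by (metis mult_eq_0_iff)
      then show ?thesis unfolding t by simp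
    qed
    moreover have "product_functional h \<phi> (star t * t) \<in> \<real>\<^sub>\<ge>\<^sub>0"
      unfolding eq' using r(2) by (simp add: sum_nonneg del: of_real_sum)
    ultimately show ?thesis by blast
  qed
  show "positive_functional (product_functional h \<phi>)"
    using sq clinear_product_functional[OF lin] by (simp add: positive_functional_def)
  then show "faithful_functional (product_functional h \<phi>)" if "faithful_functional \<phi>"
    using sq that unfolding faithful_functional_def[of "product_functional h \<phi>"] by blast
qed

section \<open>Finite quantum groups and their Haar state\<close>

lemma csubspace_range:
  assumes "clinear f"
  shows "csubspace (range f)"
proof -
  have "0 \<in> range f" using clinear_zero[OF assms] rangeI[of f 0] by simp
  moreover have "f a + f b \<in> range f" "c *\<^sub>C f a \<in> range f" for a b c
    using assms rangeI[of f "a + b"] rangeI[of f "c *\<^sub>C a"] by (simp_all add: clinear_iff)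
  ultimately show ?thesis by (auto simp: cvs.subspace_def)
qed

text \<open>The name records the leg on which the functional acts: \<open>slice_right \<phi>\<close>
  is id \<otimes> \<phi> and \<open>slice_left \<phi>\<close> is \<phi> \<otimes> id.\<close>

definition slice_right :: "('b::complex_vector \<Rightarrow> complex) \<Rightarrow> ('a::complex_vector, 'b) tensor \<Rightarrow> 'a" where
  "slice_right \<phi> = tensor_lift (\<lambda>a b. \<phi> b *\<^sub>C a)"

definition slice_left :: "('a::complex_vector \<Rightarrow> complex) \<Rightarrow> ('a, 'b::complex_vector) tensor \<Rightarrow> 'b" where
  "slice_left \<phi> = tensor_lift (\<lambda>a b. \<phi> a *\<^sub>C b)"

lemma cbilinear_slice:
  "clinear \<phi> \<Longrightarrow> cbilinear (\<lambda>a b. \<phi> b *\<^sub>C a)"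
  "clinear \<phi> \<Longrightarrow> cbilinear (\<lambda>a b. \<phi> a *\<^sub>C b)"
  by (simp_all add: clinear_iff cbilinear_iff scaleC_add_left scaleC_add_right scaleC_scaleC mult.commute)

lemma clinear_slice: "clinear \<phi> \<Longrightarrow> clinear (slice_right \<phi>)" "clinear \<phi> \<Longrightarrow> clinear (slice_left \<phi>)"
  unfolding slice_right_def slice_left_def by (intro clinear_tensor_lift cbilinear_slice; assumption)+

lemma slice_elem:
  "clinear \<phi> \<Longrightarrow> slice_right \<phi> (a \<otimes>\<^sub>C b) = \<phi> b *\<^sub>C a"
  "clinear \<psi> \<Longrightarrow> slice_left \<psi> (c \<otimes>\<^sub>C d) = \<psi> c *\<^sub>C d"
  unfolding slice_right_def slice_left_def by (simp_all add: tensor_lift_elem cbilinear_slice)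

lemma slice_right_times:
  fixes \<phi> :: "'b::complex_star_algebra \<Rightarrow> complex" and x y :: "'a::complex_star_algebra"
  assumes "clinear \<phi>"
  shows "slice_right \<phi> ((x \<otimes>\<^sub>C 1) * t) = x * slice_right \<phi> t"
    and "slice_right \<phi> (t * (x \<otimes>\<^sub>C 1)) = slice_right \<phi> t * x"
  by (induction t rule: tensor_induct)
    (simp_all add: slice_elem[OF assms] times_tensor_elem mult_scaleC_left mult_scaleC_right
      distrib_left distrib_right clinear_slice[OF assms, unfolded clinear_iff])

lemma slice_left_times:
  fixes \<phi> :: "'a::complex_star_algebra \<Rightarrow> complex" and x y :: "'b::complex_star_algebra"
  assumes "clinear \<phi>"
  shows "slice_left \<phi> ((1 \<otimes>\<^sub>C x) * t) = x * slice_left \<phi> t"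
  by (induction t rule: tensor_induct)
    (simp_all add: slice_elem[OF assms] times_tensor_elem mult_scaleC_left mult_scaleC_right
      distrib_left distrib_right clinear_slice[OF assms, unfolded clinear_iff])

lemma product_functional_slice:
  assumes "clinear \<phi>" "clinear \<psi>"
  shows "product_functional \<phi> \<psi> t = \<phi> (slice_right \<psi> t)"
    and "product_functional \<phi> \<psi> t = \<psi> (slice_left \<phi> t)"
  using assms unfolding product_functional_def slice_right_def slice_left_def
  by (simp_all add: clinear_tensor_lift_out) (simp_all add: clinear_iff mult.commute)

lemma flat_tensor_scalar:
  fixes x :: "'a::complex_star_algebra"
  assumes "x \<otimes>\<^sub>C (1::'a) = 1 \<otimes>\<^sub>C x"
  obtains c where "x = c *\<^sub>C 1"
proof -
  obtain f :: "'a \<Rightarrow> complex" where f: "clinear f" "f 1 = 1"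
    using exists_separating_functional[of "1 :: 'a"] by auto
  have "slice_right f (x \<otimes>\<^sub>C (1::'a)) = slice_right f ((1::'a) \<otimes>\<^sub>C x)" using assms by simp
  then have "x = f x *\<^sub>C 1" by (simp add: slice_elem f scaleC_one)
  then show ?thesis by (rule that)
qed

locale finite_qg =
  fixes \<Delta> :: "'a::cstar_algebra \<Rightarrow> ('a, 'a) tensor"
  assumes finite_quantum_group: "finite_quantum_group \<Delta>"
begin

lemma
  shows clinear_comult: "clinear \<Delta>"
    and comult_one: "\<Delta> 1 = 1"
    and comult_mult: "\<Delta> (x * y) = \<Delta> x * \<Delta> y"
    and comult_star: "\<Delta> (star x) = star (\<Delta> x)"
  using finite_quantum_group by (auto simp: finite_quantum_group_def unital_star_hom_def)

lemma finite_dim_exists: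
  obtains S :: "'a set" where "finite S" "cspan S = UNIV"
  using finite_quantum_group by (auto simp: finite_quantum_group_def)

text \<open>Coassociativity in Sweedler style: in an expression that is trilinear in the three legs
  it does not matter which leg was split.\<close>

lemma coassoc:
  assumes \<beta>: "ctrilinear \<beta>"
  shows "tensor_lift (\<lambda>u c. tensor_lift (\<lambda>a b. \<beta> a b c) (\<Delta> u)) (\<Delta> x) =
    tensor_lift (\<lambda>a u. tensor_lift (\<beta> a) (\<Delta> u)) (\<Delta> x)"
proof -
  have id: "clinear (id :: 'a \<Rightarrow> 'a)" by (simp add: clinear_iff)
  have "tensor_map id \<Delta> (\<Delta> x) = tensor_assoc (tensor_map \<Delta> id (\<Delta> x))"
    using finite_quantum_group unfolding finite_quantum_group_def by (metis comp_apply)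
  then have "tensor_lift (\<lambda>a t. tensor_lift (\<beta> a) t) (tensor_map id \<Delta> (\<Delta> x)) =
      tensor_lift (\<lambda>t c. tensor_lift (\<lambda>a b. \<beta> a b c) t) (tensor_map \<Delta> id (\<Delta> x))"
    by (simp add: tensor_lift_assoc[OF \<beta>])
  then show ?thesis
    by (simp add: tensor_lift_map ctrilinear_lift[OF \<beta>] clinear_comult id)
qed

section \<open>The Galois maps\<close>

definition galois :: "('a, 'a) tensor \<Rightarrow> ('a, 'a) tensor" where
  "galois = tensor_lift (\<lambda>a b. \<Delta> b * (a \<otimes>\<^sub>C 1))"

definition galois' :: "('a, 'a) tensor \<Rightarrow> ('a, 'a) tensor" where
  "galois' = tensor_lift (\<lambda>a b. \<Delta> b * (1 \<otimes>\<^sub>C a))"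

lemma cbilinear_galois:
  "cbilinear (\<lambda>a b. \<Delta> b * (a \<otimes>\<^sub>C 1))" "cbilinear (\<lambda>a b. \<Delta> b * (1 \<otimes>\<^sub>C a))"
  using clinear_comult
  by (simp_all add: cbilinear_iff clinear_iff tensor_elem_simps distrib_left distrib_right
      mult_scaleC_left mult_scaleC_right)

lemma clinear_galois: "clinear galois" "clinear galois'"
  unfolding galois_def galois'_def by (intro clinear_tensor_lift cbilinear_galois)+

lemma galois_elem:
  "galois (a \<otimes>\<^sub>C b) = \<Delta> b * (a \<otimes>\<^sub>C 1)" "galois' (a \<otimes>\<^sub>C b) = \<Delta> b * (1 \<otimes>\<^sub>C a)"
  unfolding galois_def galois'_def by (simp_all add: tensor_lift_elem cbilinear_galois)

lemma finite_dim_tensor_exists: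
  obtains S :: "('a, 'a) tensor set" where "finite S" "cspan S = UNIV"
proof -
  obtain S :: "'a set" where S: "finite S" "cspan S = UNIV" by (rule finite_dim_exists)
  obtain I :: "'a set" and e :: "'a \<Rightarrow> 'a" and \<phi> where "frame I e \<phi>"
    using S by (rule frame_exists)
  from frame_span[OF frame_tensor[OF this this]] show ?thesis by (rule that)
qed

lemma surj_galois: "surj galois" "surj galois'"
proof -
  have "{\<Delta> b * (a \<otimes>\<^sub>C 1) | a b. True} \<subseteq> range galois"
    by (auto simp flip: galois_elem)
  from cvs.span_minimal[OF this csubspace_range[OF clinear_galois(1)]]
  show "surj galois" using finite_quantum_group by (auto simp: finite_quantum_group_def)
  have "{\<Delta> b * (1 \<otimes>\<^sub>C a) | a b. True} \<subseteq> range galois'"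
    by (auto simp flip: galois_elem)
  from cvs.span_minimal[OF this csubspace_range[OF clinear_galois(2)]]
  show "surj galois'" using finite_quantum_group by (auto simp: finite_quantum_group_def)
qed

text \<open>Surjectivity is the density axiom, and finite dimension turns it into injectivity.
  Inverting the Galois maps takes over the work that an antipode usually does.\<close>

lemma inj_galois: "inj galois" "inj galois'"
proof -
  obtain S :: "('a, 'a) tensor set" where S: "finite S" "cspan S = UNIV"
    by (rule finite_dim_tensor_exists)
  show "inj galois" "inj galois'"
    by (rule clinear_surj_imp_inj[OF S clinear_galois(1) surj_galois(1)]
        clinear_surj_imp_inj[OF S clinear_galois(2) surj_galois(2)])+
qed

text \<open>In either case the matching Galois map sends both x \<otimes> 1 and 1 \<otimes> x to
  \<Delta>(x), so injectivity identifies the two.\<close>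

lemma coinvariant_scalar:
  assumes "\<Delta> x = x \<otimes>\<^sub>C 1 \<or> \<Delta> x = 1 \<otimes>\<^sub>C x"
  obtains c where "x = c *\<^sub>C 1"
proof -
  have one: "\<Delta> 1 = 1 \<otimes>\<^sub>C 1" by (simp add: comult_one one_tensor_elem)
  have "x \<otimes>\<^sub>C 1 = 1 \<otimes>\<^sub>C x"
  proof (rule disjE[OF assms])
    assume "\<Delta> x = x \<otimes>\<^sub>C 1"
    then have "galois (x \<otimes>\<^sub>C 1) = galois (1 \<otimes>\<^sub>C x)"
      by (simp add: galois_elem one times_tensor_elem)
    then show ?thesis by (rule injD[OF inj_galois(1)])
  next
    assume "\<Delta> x = 1 \<otimes>\<^sub>C x"
    then have "galois' (x \<otimes>\<^sub>C 1) = galois' (1 \<otimes>\<^sub>C x)"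
      by (simp add: galois_elem one times_tensor_elem)
    then show ?thesis by (rule injD[OF inj_galois(2)])
  qed
  then show ?thesis using that by (rule flat_tensor_scalar)
qed

section \<open>Convolution and the operators (id \<otimes> \<phi>)\<Delta> and (\<phi> \<otimes>
  id)\<Delta>\<close>

definition transl :: "('a \<Rightarrow> complex) \<Rightarrow> 'a \<Rightarrow> 'a" where
  "transl \<phi> a = slice_right \<phi> (\<Delta> a)"

definition transl' :: "('a \<Rightarrow> complex) \<Rightarrow> 'a \<Rightarrow> 'a" where
  "transl' \<phi> a = slice_left \<phi> (\<Delta> a)"

lemma clinear_transl: "clinear \<phi> \<Longrightarrow> clinear (transl \<phi>)" "clinear \<phi> \<Longrightarrow> clinear (transl' \<phi>)"
  unfolding transl_def[abs_def] transl'_def[abs_def]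
  by (erule clinear_compose[OF clinear_slice(1) clinear_comult] clinear_compose[OF clinear_slice(2) clinear_comult])+

lemma convolution_eq: "convolution \<Delta> \<phi> \<psi> a = product_functional \<phi> \<psi> (\<Delta> a)"
  by (simp add: convolution_def product_functional_def)

lemma clinear_convolution:
  assumes "clinear \<phi>" "clinear \<psi>"
  shows "clinear (convolution \<Delta> \<phi> \<psi>)"
  unfolding convolution_eq[abs_def]
  by (rule clinear_compose[OF clinear_product_functional[OF assms] clinear_comult])

lemma convolution_transl:
  assumes "clinear \<phi>" "clinear \<psi>"
  shows "convolution \<Delta> \<phi> \<psi> a = \<phi> (transl \<psi> a)" "convolution \<Delta> \<phi> \<psi> a = \<psi> (transl' \<phi> a)"
  unfolding convolution_eq transl_def transl'_def
  by (rule product_functional_slice[OF assms])+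

text \<open>By coassociativity \<open>transl\<close> carries convolution to composition. Idempotent
  functionals thus give idempotent operators, and the order on them becomes a statement about
  ranges.\<close>

lemma transl_transl:
  assumes "clinear \<phi>" "clinear \<psi>"
  shows "transl \<phi> (transl \<psi> x) = transl (convolution \<Delta> \<phi> \<psi>) x"
proof -
  have t: "ctrilinear (\<lambda>a b c. (\<phi> b * \<psi> c) *\<^sub>C a)"
    using assms by (auto simp: ctrilinear_def cbilinear_iff clinear_iff distrib_left distrib_right
        scaleC_add_left scaleC_add_right scaleC_scaleC mult_ac)
  have out: "tensor_lift (\<lambda>b c. \<phi> b * \<psi> c) w *\<^sub>C a = tensor_lift (\<lambda>b c. (\<phi> b * \<psi> c) *\<^sub>C a) w"
    for w and a :: 'a
    by (rule clinear_tensor_lift_out[of "\<lambda>k. k *\<^sub>C a"]) (simp add: clinear_iff scaleC_add_left scaleC_scaleC)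
  have "transl \<phi> (transl \<psi> x) = tensor_lift (\<lambda>u c. \<psi> c *\<^sub>C transl \<phi> u) (\<Delta> x)"
    unfolding transl_def[of \<psi>] slice_right_def
    using clinear_transl(1)[OF assms(1)] by (simp add: clinear_tensor_lift_out) (simp add: clinear_iff)
  also have "\<dots> = tensor_lift (\<lambda>u c. tensor_lift (\<lambda>a b. (\<phi> b * \<psi> c) *\<^sub>C a) (\<Delta> u)) (\<Delta> x)"
    unfolding transl_def slice_right_def
    by (simp add: scaleC_scaleC mult.commute flip: tensor_lift_fun(2))
  also have "\<dots> = tensor_lift (\<lambda>a u. tensor_lift (\<lambda>b c. (\<phi> b * \<psi> c) *\<^sub>C a) (\<Delta> u)) (\<Delta> x)"
    by (rule coassoc[OF t])
  also have "\<dots> = transl (convolution \<Delta> \<phi> \<psi>) x"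
    unfolding transl_def slice_right_def convolution_def comp_def out ..
  finally show ?thesis .
qed

text \<open>The functional applied first consumes the leftmost leg, so here composition reverses the
  order of the convolution.\<close>

lemma transl'_transl':
  assumes "clinear \<phi>" "clinear \<psi>"
  shows "transl' \<phi> (transl' \<psi> x) = transl' (convolution \<Delta> \<psi> \<phi>) x"
proof -
  have t: "ctrilinear (\<lambda>a b c. (\<psi> a * \<phi> b) *\<^sub>C c)"
    using assms by (auto simp: ctrilinear_def cbilinear_iff clinear_iff distrib_left distrib_right
        scaleC_add_left scaleC_add_right scaleC_scaleC mult_ac)
  have out: "tensor_lift (\<lambda>a b. \<psi> a * \<phi> b) w *\<^sub>C c = tensor_lift (\<lambda>a b. (\<psi> a * \<phi> b) *\<^sub>C c) w"
    for w and c :: 'a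
    by (rule clinear_tensor_lift_out[of "\<lambda>k. k *\<^sub>C c"]) (simp add: clinear_iff scaleC_add_left scaleC_scaleC)
  have "transl' \<phi> (transl' \<psi> x) = tensor_lift (\<lambda>a u. \<psi> a *\<^sub>C transl' \<phi> u) (\<Delta> x)"
    unfolding transl'_def[of \<psi>] slice_left_def
    using clinear_transl(2)[OF assms(1)] by (simp add: clinear_tensor_lift_out) (simp add: clinear_iff)
  also have "\<dots> = tensor_lift (\<lambda>a u. tensor_lift (\<lambda>b c. (\<psi> a * \<phi> b) *\<^sub>C c) (\<Delta> u)) (\<Delta> x)"
    unfolding transl'_def slice_left_def
    by (simp add: scaleC_scaleC flip: tensor_lift_fun(2))
  also have "\<dots> = tensor_lift (\<lambda>u c. tensor_lift (\<lambda>a b. (\<psi> a * \<phi> b) *\<^sub>C c) (\<Delta> u)) (\<Delta> x)"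
    by (rule coassoc[OF t, symmetric])
  also have "\<dots> = transl' (convolution \<Delta> \<psi> \<phi>) x"
    unfolding transl'_def slice_left_def convolution_def comp_def out ..
  finally show ?thesis .
qed

text \<open>The functional consumes the last leg, so the first leg passes through untouched. This
  covariance puts \<Delta> of the range into A tensor the range, and
  \<open>covariant_is_transl\<close> shows that it characterizes translations.\<close>

lemma comult_transl:
  assumes "clinear \<phi>"
  shows "\<Delta> (transl \<phi> x) = tensor_map id (transl \<phi>) (\<Delta> x)"
proof -
  have t: "ctrilinear (\<lambda>a b c. \<phi> c *\<^sub>C (a \<otimes>\<^sub>C b))"
    using assms by (auto simp: ctrilinear_def cbilinear_iff clinear_iff tensor_elem_simps
        scaleC_add_left scaleC_add_right scaleC_scaleC mult.commute)
  have elem: "tensor_lift (\<lambda>a b. a \<otimes>\<^sub>C b) u = u" for u :: "('a, 'a) tensor"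
    by (rule clinear_eq_tensor[where g = "\<lambda>x. x"])
      (simp_all add: clinear_tensor_lift tensor_lift_elem cbilinear_tensor_elem clinear_iff[of "\<lambda>x. x"])
  have "\<Delta> (transl \<phi> x) = tensor_lift (\<lambda>u c. \<phi> c *\<^sub>C \<Delta> u) (\<Delta> x)"
    unfolding transl_def slice_right_def
    using clinear_comult by (simp add: clinear_tensor_lift_out) (simp add: clinear_iff)
  also have "\<dots> = tensor_lift (\<lambda>u c. tensor_lift (\<lambda>a b. \<phi> c *\<^sub>C (a \<otimes>\<^sub>C b)) (\<Delta> u)) (\<Delta> x)"
    by (simp add: tensor_lift_fun(2) elem)
  also have "\<dots> = tensor_lift (\<lambda>a u. tensor_lift (\<lambda>b c. \<phi> c *\<^sub>C (a \<otimes>\<^sub>C b)) (\<Delta> u)) (\<Delta> x)"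
    by (rule coassoc[OF t])
  also have "\<dots> = tensor_map id (transl \<phi>) (\<Delta> x)"
    unfolding tensor_map_def transl_def slice_right_def id_apply
    by (simp add: clinear_tensor_lift_out clinear_tensor_elem tensor_elem_simps)
  finally show ?thesis .
qed

lemma transl_star:
  assumes "positive_functional \<phi>"
  shows "transl \<phi> (star x) = star (transl \<phi> x)" "transl' \<phi> (star x) = star (transl' \<phi> x)"
proof -
  have lin: "clinear \<phi>" using assms by (rule positive_functional_clinear)
  have "slice_right \<phi> (star t) = star (slice_right \<phi> t)" for t :: "('a, 'a) tensor"
    by (induction t rule: tensor_induct)
      (simp_all add: star_tensor_elem slice_elem[OF lin] star_scaleC star_add positive_functional_star[OF assms]
        clinear_slice[OF lin, unfolded clinear_iff])
  then show "transl \<phi> (star x) = star (transl \<phi> x)" by (simp add: transl_def comult_star)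
  have "slice_left \<phi> (star t) = star (slice_left \<phi> t)" for t :: "('a, 'a) tensor"
    by (induction t rule: tensor_induct)
      (simp_all add: star_tensor_elem slice_elem[OF lin] star_scaleC star_add positive_functional_star[OF assms]
        clinear_slice[OF lin, unfolded clinear_iff])
  then show "transl' \<phi> (star x) = star (transl' \<phi> x)" by (simp add: transl'_def comult_star)
qed

section \<open>Existence of the Haar state\<close>

lemma tracial_idempotent_exists:
  obtains h :: "'a \<Rightarrow> complex" where "faithful_functional h" "h 1 = 1" "\<And>a b. h (a * b) = h (b * a)"
    "convolution \<Delta> h h = h"
proof -
  obtain I :: "'a set" and e \<phi> where fr: "frame I (e :: 'a \<Rightarrow> 'a) \<phi>"
  proof -
    obtain S :: "'a set" where "finite S" "cspan S = UNIV" by (rule finite_dim_exists)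
    then show ?thesis using that by (rule frame_exists)
  qed
  define \<tau> where "\<tau> a = frame_trace I e \<phi> (\<lambda>x. a * x)" for a
  note \<tau> = regular_trace_faithful[OF cstar_proper_involution fr, folded \<tau>_def]
  have ft: "faithful_functional \<tau>" using \<tau>(2) by (simp add: \<tau>_def[abs_def])
  have lin: "clinear \<tau>" using ft by (simp add: faithful_functional_positive positive_functional_clinear)
  let ?J = "I \<times> I" and ?d = "\<lambda>(i, j). e i \<otimes>\<^sub>C e j"
    and ?\<psi> = "\<lambda>(i, j). tensor_lift (\<lambda>a b. \<phi> i a * \<phi> j b)"
  note fr2 = frame_tensor[OF fr fr]
  have lin\<phi>: "clinear (\<phi> i)" if "i \<in> I" for i using fr that by (simp add: frame_def)
  have mult: "clinear (\<lambda>y. x * y)" "clinear (\<lambda>y. y * x)" for x :: "'b::complex_star_algebra"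
    by (simp_all add: clinear_iff distrib_left distrib_right mult_scaleC_left mult_scaleC_right)
  \<comment> \<open>\<tau> \<otimes> \<tau> is the regular trace of the tensor square; conjugating a
    left multiplication by the Galois map therefore does not change its value.\<close>
  have \<tau>\<tau>: "product_functional \<tau> \<tau> t = frame_trace ?J ?d ?\<psi> (\<lambda>x. t * x)" for t
  proof (rule clinear_eq_tensor)
    show "clinear (product_functional \<tau> \<tau>)" by (rule clinear_product_functional[OF lin lin])
    have "clinear (?\<psi> i)" if "i \<in> ?J" for i
      using that fr2 by (simp only: frame_def)
    from clinear_compose[OF this mult(2)]
    show "clinear (\<lambda>t. frame_trace ?J ?d ?\<psi> (\<lambda>x. t * x))"
      unfolding frame_trace_def by (rule clinear_sum_fun)
    fix a b
    have "?\<psi> ij ((a \<otimes>\<^sub>C b) * ?d ij) = (case ij of (i, j) \<Rightarrow> \<phi> i (a * e i) * \<phi> j (b * e j))"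
      if "ij \<in> ?J" for ij
      using that by (auto simp: times_tensor_elem tensor_lift_elem cbilinear_product lin\<phi>)
    then have "frame_trace ?J ?d ?\<psi> (\<lambda>x. (a \<otimes>\<^sub>C b) * x) = (\<Sum>(i, j)\<in>?J. \<phi> i (a * e i) * \<phi> j (b * e j))"
      unfolding frame_trace_def by (intro sum.cong refl)
    then show "product_functional \<tau> \<tau> (a \<otimes>\<^sub>C b) = frame_trace ?J ?d ?\<psi> (\<lambda>x. (a \<otimes>\<^sub>C b) * x)"
      by (simp add: product_functional_elem lin \<tau>_def frame_trace_def sum_product sum.cartesian_product)
  qed
  have conv: "product_functional \<tau> \<tau> (\<Delta> a) = \<tau> a * \<tau> 1" for a
  proof -
    have bij: "bij galois" using inj_galois(1) surj_galois(1) by (simp add: bij_def)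
    note inv = surj_f_inv_f[OF surj_galois(1)] inv_f_f[OF inj_galois(1)]
    let ?G = "inv galois"
    have gal: "galois ((1 \<otimes>\<^sub>C a) * t) = \<Delta> a * galois t" for t
      by (induction t rule: tensor_induct)
        (simp_all add: times_tensor_elem galois_elem comult_mult mult.assoc distrib_left
          clinear_galois[unfolded clinear_iff])
    have "product_functional \<tau> \<tau> (\<Delta> a) =
        frame_trace ?J ?d ?\<psi> (\<lambda>x. galois ((1 \<otimes>\<^sub>C a) * ?G x))"
      unfolding \<tau>\<tau> gal inv ..
    also have "\<dots> = frame_trace ?J ?d ?\<psi> (\<lambda>x. (1 \<otimes>\<^sub>C a) * ?G (galois x))"
      by (rule frame_trace_commute[OF fr2 fr2 clinear_galois(1)])
        (intro clinear_compose[OF mult(1) clinear_inv[OF clinear_galois(1) bij]])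
    also have "\<dots> = product_functional \<tau> \<tau> (1 \<otimes>\<^sub>C a)"
      by (simp add: \<tau>\<tau> inv)
    finally show ?thesis by (simp add: product_functional_elem lin)
  qed
  \<comment> \<open>Since \<tau> \<star> \<tau> = n \<tau>, division by n is exactly what makes the
    functional idempotent. It is possible because \<tau> is faithful and 1 =
    \<open>star 1 * 1\<close>.\<close>
  define n where "n = \<tau> 1"
  have n: "n \<in> \<real>\<^sub>\<ge>\<^sub>0" "n \<noteq> 0"
    using ft unfolding faithful_functional_def positive_functional_def n_def
    by (metis mult_1 star_one, metis mult_1 star_one zero_neq_one)
  then have in': "inverse n \<in> \<real>\<^sub>\<ge>\<^sub>0" by simp
  define h where "h a = inverse n * \<tau> a" for a
  have linh: "clinear h" using lin by (simp add: h_def clinear_iff algebra_simps)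
  have "positive_functional h"
    using ft in' linh unfolding faithful_functional_def positive_functional_def h_def
    by (auto intro: nonneg_Reals_mult_I)
  then have "faithful_functional h"
    using ft n(2) unfolding faithful_functional_def h_def by simp
  moreover have "h 1 = 1" using n(2) by (simp add: h_def n_def)
  moreover have "h (a * b) = h (b * a)" for a b using \<tau>(1)[of a b] by (simp add: h_def)
  moreover have "convolution \<Delta> h h = h"
  proof
    fix a
    have "convolution \<Delta> h h a = inverse n * inverse n * product_functional \<tau> \<tau> (\<Delta> a)"
      unfolding convolution_def product_functional_def comp_def h_def
      using tensor_lift_fun(2)[of "inverse n * inverse n" "\<lambda>a b. \<tau> a * \<tau> b" "\<Delta> a"]
      by (simp add: mult_ac)
    also have "\<dots> = h a" using n(2) by (simp add: conv n_def h_def)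
    finally show "convolution \<Delta> h h a = h a" .
  qed
  ultimately show ?thesis by (rule that)
qed

text \<open>A faithful idempotent state is the Haar state: its translation operator fixes only scalars.\<close>

lemma haar_exists:
  obtains h :: "'a \<Rightarrow> complex" where "faithful_functional h" "h 1 = 1" "\<And>a b. h (a * b) = h (b * a)"
    "\<And>a. transl h a = h a *\<^sub>C 1" "\<And>a. transl' h a = h a *\<^sub>C 1"
proof -
  obtain h :: "'a \<Rightarrow> complex" where h: "faithful_functional h" "h 1 = 1" "\<And>a b. h (a * b) = h (b * a)"
    and idem: "convolution \<Delta> h h = h"
    using tracial_idempotent_exists by blast
  have pos: "positive_functional h" using h(1) by (rule faithful_functional_positive)
  have lin: "clinear h" using pos by (rule positive_functional_clinear)
  obtain S :: "'a set" where S: "finite S" "cspan S = UNIV" by (rule finite_dim_exists)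
  define H where "H = (product_functional h h :: ('a, 'a) tensor \<Rightarrow> complex)"
  have HF: "faithful_functional H"
    unfolding H_def by (rule product_functional_positive(2)[OF S h(1) pos h(1)])
  note HP = faithful_functional_positive[OF HF]
  have H\<Delta>: "H (star (\<Delta> x) * \<Delta> x) = h (star x * x)" for x
    using idem convolution_eq[of h h "star x * x"] by (simp add: H_def comult_mult comult_star)
  have vanish: "t = u" if "H (star (t - u) * (t - u)) = 0" for t u
    using HF that unfolding faithful_functional_def by (metis right_minus_eq)
  have "transl h a = h a *\<^sub>C 1" for a
  proof -
    define x where "x = transl h a"
    have x: "transl h x = x" by (simp add: x_def transl_transl lin idem)
    \<comment> \<open>Invariance of x under \<open>transl h\<close> makes this mixed term equal to
      both squares, so H cannot distinguish \<Delta>(x) from x \<otimes> 1.\<close>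
    have "H (star (x \<otimes>\<^sub>C 1) * \<Delta> x) = h (star x * x)"
      by (simp add: H_def star_tensor_elem product_functional_slice(1)[OF lin lin] slice_right_times lin
          x[unfolded transl_def])
    moreover have "H (star (x \<otimes>\<^sub>C 1) * (x \<otimes>\<^sub>C 1)) = h (star x * x)"
      by (simp add: H_def star_tensor_elem times_tensor_elem product_functional_elem lin h(2))
    ultimately have "\<Delta> x = x \<otimes>\<^sub>C 1"
      by (intro vanish positive_functional_diff_null[OF HP H\<Delta>])
    then obtain c where c: "x = c *\<^sub>C 1" using coinvariant_scalar by blast
    \<comment> \<open>Applying h identifies the scalar: h(x) = (h \<star> h)(a) = h(a).\<close>
    have "h x = h a" using convolution_transl(1)[OF lin lin, of a] by (simp add: x_def idem)
    with c have "c = h a" using lin h(2) by (simp add: clinear_iff)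
    with c show ?thesis by (simp add: x_def)
  qed
  moreover have "transl' h a = h a *\<^sub>C 1" for a
  proof -
    define x where "x = transl' h a"
    have x: "transl' h x = x" by (simp add: x_def transl'_transl' lin idem)
    have "H (star (1 \<otimes>\<^sub>C x) * \<Delta> x) = h (star x * x)"
      by (simp add: H_def star_tensor_elem product_functional_slice(2)[OF lin lin] slice_left_times lin
          x[unfolded transl'_def])
    moreover have "H (star (1 \<otimes>\<^sub>C x) * (1 \<otimes>\<^sub>C x)) = h (star x * x)"
      by (simp add: H_def star_tensor_elem times_tensor_elem product_functional_elem lin h(2))
    ultimately have "\<Delta> x = 1 \<otimes>\<^sub>C x"
      by (intro vanish positive_functional_diff_null[OF HP H\<Delta>])
    then obtain c where c: "x = c *\<^sub>C 1" using coinvariant_scalar by blast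
    have "h x = h a" using convolution_transl(2)[OF lin lin, of a] by (simp add: x_def idem)
    with c have "c = h a" using lin h(2) by (simp add: clinear_iff)
    with c show ?thesis by (simp add: x_def)
  qed
  ultimately show ?thesis using h that by blast
qed

section \<open>Translation operators\<close>

text \<open>id \<otimes> \<phi> is right A-linear in the first leg, so \<open>transl \<phi>\<close>
  determines it on the elements \<Delta>(b)(a \<otimes> 1), which span; evaluation at 1 \<otimes> y
  returns \<phi>(y).\<close>

lemma transl_inject:
  assumes lin: "clinear \<phi>" "clinear \<psi>" and eq: "\<And>a. transl \<phi> a = transl \<psi> a"
  shows "\<phi> = \<psi>"
proof
  fix y
  have "slice_right \<phi> (galois s) = slice_right \<psi> (galois s)" for s
    by (rule clinear_eq_tensor[OF clinear_compose[OF clinear_slice(1)[OF lin(1)] clinear_galois(1)]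
          clinear_compose[OF clinear_slice(1)[OF lin(2)] clinear_galois(1)]])
      (use eq in \<open>simp add: galois_elem slice_right_times lin transl_def\<close>)
  moreover obtain s where "(1::'a) \<otimes>\<^sub>C y = galois s" using surjD[OF surj_galois(1)] by blast
  ultimately have "slice_right \<phi> ((1::'a) \<otimes>\<^sub>C y) = slice_right \<psi> ((1::'a) \<otimes>\<^sub>C y)" by simp
  then show "\<phi> y = \<psi> y" by (simp add: slice_elem lin)
qed

text \<open>For \<open>E = id\<close> the functional obtained here is the counit. The map \<open>F\<close> sends
  \<open>\<Delta>(b)(a \<otimes> 1)\<close> to \<open>E(b)a\<close>, and coassociativity shows that \<open>F(1 \<otimes> y)\<close> is coinvariant.\<close>

lemma covariant_is_transl:
  assumes linE: "clinear E" and cov: "\<And>a. \<Delta> (E a) = tensor_map id E (\<Delta> a)"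
  obtains \<phi> where "clinear \<phi>" "\<And>a. transl \<phi> a = E a"
proof -
  note elem = tensor_elem_simps times_tensor_elem
  define L where "L = tensor_lift (\<lambda>a b. E b * a)"
  have bL: "cbilinear (\<lambda>a b. E b * a)"
    using linE by (simp add: cbilinear_iff clinear_iff distrib_left distrib_right mult_scaleC_left mult_scaleC_right)
  have linL: "clinear L" unfolding L_def by (rule clinear_tensor_lift[OF bL])
  have L: "L (a \<otimes>\<^sub>C b) = E b * a" for a b unfolding L_def by (rule tensor_lift_elem[OF bL])
  \<comment> \<open>F makes sense on all of A \<otimes> A because the Galois map is bijective. It is
    right A-linear in the first leg and turns out to be id \<otimes> \<phi>.\<close>
  define F where "F t = L (inv galois t)" for t
  have bij: "bij galois" using inj_galois(1) surj_galois(1) by (simp add: bij_def)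
  have linF: "clinear F"
    unfolding F_def[abs_def] by (rule clinear_compose[OF linL clinear_inv[OF clinear_galois(1) bij]])
  have Fgal: "F (galois s) = L s" for s
    by (simp add: F_def inv_f_f inj_galois)
  have onto: "\<exists>s. t = galois s" for t using surj_galois(1) by (rule surjD)
  have galois_right: "galois s * (a \<otimes>\<^sub>C 1) = galois (s * (a \<otimes>\<^sub>C 1))" for s a
    by (induction s rule: tensor_induct)
      (simp_all add: galois_elem elem mult.assoc distrib_right clinear_galois[unfolded clinear_iff])
  have L_right: "L (s * (a \<otimes>\<^sub>C 1)) = L s * a" for s a
    by (induction s rule: tensor_induct)
      (simp_all add: L elem mult.assoc distrib_right linL[unfolded clinear_iff])
  have F_right: "F (t * (a \<otimes>\<^sub>C 1)) = F t * a" for t a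
  proof -
    obtain s where "t = galois s" using onto by blast
    then show ?thesis by (simp add: galois_right Fgal L_right)
  qed
  have F_mult: "F ((q * q') \<otimes>\<^sub>C v) = F (q \<otimes>\<^sub>C v) * q'" for q q' v
    using F_right[of "q \<otimes>\<^sub>C v" q'] by (simp add: elem)
  have tri: "ctrilinear (\<lambda>(p::'a) q v. p \<otimes>\<^sub>C F (q \<otimes>\<^sub>C v))"
    using linF by (auto simp: ctrilinear_def cbilinear_iff clinear_iff elem)
  define K where "K v = tensor_lift (\<lambda>(p::'a) q. p \<otimes>\<^sub>C F (q \<otimes>\<^sub>C v))" for v
  have bK: "cbilinear (\<lambda>(p::'a) q. p \<otimes>\<^sub>C F (q \<otimes>\<^sub>C v))" for v
    using tri unfolding ctrilinear_def by blast
  have linK: "clinear (K v)" for v unfolding K_def by (rule clinear_tensor_lift[OF bK])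
  have K: "K v (p \<otimes>\<^sub>C q) = p \<otimes>\<^sub>C F (q \<otimes>\<^sub>C v)" for v p q
    unfolding K_def by (rule tensor_lift_elem[OF bK])
  have K_mult: "K v (t * t') = K v t * t'" for v t t'
  proof (induction t rule: tensor_induct)
    case (elem p q)
    show ?case
      by (induction t' rule: tensor_induct)
        (simp_all add: K times_tensor_elem F_mult distrib_left linK[unfolded clinear_iff])
  qed (simp add: distrib_right linK[unfolded clinear_iff])
  \<comment> \<open>J is (id \<otimes> F)(\<Delta> \<otimes> id). Coassociativity and the covariance
    of E will give J = \<Delta> F.\<close>
  define J where "J = tensor_lift (\<lambda>u v. K v (\<Delta> u))"
  have bJ: "cbilinear (\<lambda>u v. K v (\<Delta> u))"
    using ctrilinear_lift(2)[OF tri] clinear_comult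
    by (simp add: K_def[symmetric] cbilinear_iff clinear_iff)
  have linJ: "clinear J" unfolding J_def by (rule clinear_tensor_lift[OF bJ])
  have J: "J (u \<otimes>\<^sub>C v) = K v (\<Delta> u)" for u v unfolding J_def by (rule tensor_lift_elem[OF bJ])
  have J_right: "J (t * (a \<otimes>\<^sub>C 1)) = J t * \<Delta> a" for t a
    by (induction t rule: tensor_induct)
      (simp_all add: J elem comult_mult K_mult distrib_right linJ[unfolded clinear_iff])
  have F_comult: "F (\<Delta> b) = E b" for b
    using Fgal[of "1 \<otimes>\<^sub>C b"] by (simp add: galois_elem L flip: one_tensor_elem)
  have J_comult: "J (\<Delta> b) = \<Delta> (E b)" for b
  proof -
    have "J (\<Delta> b) = tensor_lift (\<lambda>p u. tensor_lift (\<lambda>q v. p \<otimes>\<^sub>C F (q \<otimes>\<^sub>C v)) (\<Delta> u)) (\<Delta> b)"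
      unfolding J_def K_def by (rule coassoc[OF tri])
    also have "\<dots> = tensor_lift (\<lambda>p u. p \<otimes>\<^sub>C E u) (\<Delta> b)"
    proof -
      have bp: "cbilinear (\<lambda>q v. p \<otimes>\<^sub>C F (q \<otimes>\<^sub>C v))" for p :: 'a
        using tri unfolding ctrilinear_def by blast
      have "tensor_lift (\<lambda>q v. p \<otimes>\<^sub>C F (q \<otimes>\<^sub>C v)) t = p \<otimes>\<^sub>C F t" for p :: 'a and t
      proof (induction t rule: tensor_induct)
        case (elem q v)
        show ?case by (rule tensor_lift_elem[OF bp])
      next
        case (add t t')
        then show ?case
          using linF by (simp add: tensor_lift_add[OF bp] tensor_elem_simps clinear_iff)
      qed
      then show ?thesis by (simp add: F_comult)
    qed
    also have "\<dots> = \<Delta> (E b)" by (simp add: cov tensor_map_def)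
    finally show ?thesis .
  qed
  \<comment> \<open>Both sides turn right multiplication by a \<otimes> 1 into right multiplication
    by \<Delta>(a), so it suffices to compare them at \<Delta>(b), where both give \<Delta>(E
    b).\<close>
  have "J (galois s) = \<Delta> (F (galois s))" for s
    by (induction s rule: tensor_induct)
      (simp_all add: galois_elem J_right J_comult F_right F_comult comult_mult
        clinear_galois[unfolded clinear_iff] linJ[unfolded clinear_iff] linF[unfolded clinear_iff]
        clinear_comult[unfolded clinear_iff])
  then have JF: "J t = \<Delta> (F t)" for t using onto[of t] by blast
  have scalar: "\<exists>c. F (1 \<otimes>\<^sub>C y) = c *\<^sub>C 1" for y
  proof -
    \<comment> \<open>As \<Delta>(1) = 1 \<otimes> 1, the identity \<Delta> F = J exhibits F(1
      \<otimes> y) as coinvariant.\<close>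
    have "\<Delta> (F (1 \<otimes>\<^sub>C y)) = 1 \<otimes>\<^sub>C F (1 \<otimes>\<^sub>C y)"
      unfolding JF[symmetric] J comult_one one_tensor_elem K ..
    then show ?thesis using coinvariant_scalar by blast
  qed
  obtain f :: "'a \<Rightarrow> complex" where f: "clinear f" "f 1 = 1"
    using exists_separating_functional[of "1 :: 'a"] by auto
  define \<phi> where "\<phi> y = f (F (1 \<otimes>\<^sub>C y))" for y
  have lin\<phi>: "clinear \<phi>"
    unfolding \<phi>_def[abs_def] by (rule clinear_compose[OF f(1) clinear_compose[OF linF clinear_tensor_elem(1)]])
  have "F (1 \<otimes>\<^sub>C y) = \<phi> y *\<^sub>C 1" for y
    using scalar[of y] f by (auto simp: \<phi>_def clinear_iff)
  then have "F (x \<otimes>\<^sub>C y) = slice_right \<phi> (x \<otimes>\<^sub>C y)" for x y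
    using F_mult[of 1 x y] by (simp add: slice_elem lin\<phi> mult_scaleC_left)
  then have "F t = slice_right \<phi> t" for t
    by (rule clinear_eq_tensor[OF linF clinear_slice(1)[OF lin\<phi>]])
  then have "transl \<phi> a = E a" for a by (simp add: transl_def F_comult flip: F_comult)
  with lin\<phi> show ?thesis by (rule that)
qed

end

locale haar_qg = finite_qg \<Delta> for \<Delta> :: "'a::cstar_algebra \<Rightarrow> ('a, 'a) tensor" +
  fixes h :: "'a \<Rightarrow> complex"
  assumes haar_faithful: "faithful_functional h"
    and haar_one: "h 1 = 1"
    and haar_trace: "h (a * b) = h (b * a)"
    and haar_right: "transl h a = h a *\<^sub>C 1"
    and haar_left: "transl' h a = h a *\<^sub>C 1"
begin

lemma haar_positive: "positive_functional h"
  using haar_faithful by (rule faithful_functional_positive)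

lemma clinear_haar: "clinear h"
  using haar_positive by (rule positive_functional_clinear)

lemma haar_product_positive: "positive_functional \<phi> \<Longrightarrow> positive_functional (product_functional h \<phi>)"
  for \<phi> :: "'a \<Rightarrow> complex"
  using finite_dim_exists product_functional_positive(1) haar_faithful by metis

text \<open>Evaluate h \<star> \<phi> in two ways: slicing with \<phi> first gives the left side,
  slicing with h first gives h(a) \<phi>(1).\<close>

lemma haar_transl:
  assumes "clinear \<phi>" "\<phi> 1 = 1"
  shows "h (transl \<phi> a) = h a"
  using assms convolution_transl[OF clinear_haar assms(1), of a]
  by (simp add: haar_left) (simp add: clinear_iff)

section \<open>From idempotent states to coidalgebras\<close>

text \<open>The functional \<open>h \<otimes> \<phi>\<close> vanishes on \<open>T\<^sup>*T\<close> for \<open>T = \<Delta> x - x \<otimes> 1\<close>, so by Cauchy--Schwarz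
  on all multiples of \<open>T\<close>.\<close>

lemma transl_module:
  assumes pos: "positive_functional \<phi>" and one: "\<phi> 1 = 1" and fixed: "transl \<phi> x = x"
  shows "transl \<phi> (y * x) = transl \<phi> y * x"
proof -
  have lin: "clinear \<phi>" using pos by (rule positive_functional_clinear)
  define H where "H = product_functional h \<phi>"
  have H: "H t = h (slice_right \<phi> t)" for t
    unfolding H_def by (rule product_functional_slice(1)[OF clinear_haar lin])
  have "H (star (\<Delta> x) * \<Delta> x) = h (star x * x)"
    using haar_transl[OF lin one, of "star x * x"] by (simp add: H transl_def comult_mult comult_star)
  moreover have "H (star (x \<otimes>\<^sub>C 1) * (x \<otimes>\<^sub>C 1)) = h (star x * x)"
    by (simp add: H star_tensor_elem times_tensor_elem slice_elem lin one scaleC_one)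
  moreover have "H (star (x \<otimes>\<^sub>C 1) * \<Delta> x) = h (star x * x)"
    using fixed by (simp add: H star_tensor_elem slice_right_times lin transl_def)
  ultimately have "H (star (\<Delta> x - x \<otimes>\<^sub>C 1) * (\<Delta> x - x \<otimes>\<^sub>C 1)) = 0"
    using haar_product_positive[OF pos] unfolding H_def by (intro positive_functional_diff_null)
  then have null: "H (z * (\<Delta> x - x \<otimes>\<^sub>C 1)) = 0" for z
    using haar_product_positive[OF pos] unfolding H_def by (rule positive_functional_null[rotated])
  have "transl \<phi> (y * x) - transl \<phi> y * x = 0"
  proof (rule faithful_nondegenerate[OF haar_faithful])
    fix w
    \<comment> \<open>The defect of the module property is a slice of \<Delta>(y)(\<Delta>(x) - x
      \<otimes> 1), so testing it against w under h gives a value covered by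
      \<open>null\<close>.\<close>
    have "slice_right \<phi> (\<Delta> y * (\<Delta> x - x \<otimes>\<^sub>C 1)) = transl \<phi> (y * x) - transl \<phi> y * x"
      by (simp add: right_diff_distrib clinear_diff[OF clinear_slice(1)[OF lin]] slice_right_times lin
          transl_def comult_mult)
    then show "h (w * (transl \<phi> (y * x) - transl \<phi> y * x)) = 0"
      using null[of "(w \<otimes>\<^sub>C 1) * \<Delta> y"] by (simp add: H mult.assoc slice_right_times lin)
  qed
  then show ?thesis by simp
qed

lemma idempotent_stateD:
  assumes "idempotent_state \<Delta> \<phi>"
  shows "clinear \<phi>" "positive_functional \<phi>" "\<phi> 1 = 1" "convolution \<Delta> \<phi> \<phi> = \<phi>"
    "transl \<phi> (transl \<phi> a) = transl \<phi> a" "transl \<phi> 1 = 1"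
    "x \<in> range (transl \<phi>) \<longleftrightarrow> transl \<phi> x = x"
proof -
  show *: "clinear \<phi>" "positive_functional \<phi>" "\<phi> 1 = 1" "convolution \<Delta> \<phi> \<phi> = \<phi>"
    using assms by (auto simp: idempotent_state_def state_def positive_functional_def)
  show **: "transl \<phi> (transl \<phi> a) = transl \<phi> a" for a
    by (simp add: transl_transl *)
  show "transl \<phi> 1 = 1"
    by (simp add: transl_def comult_one one_tensor_elem slice_elem * scaleC_one)
  show "x \<in> range (transl \<phi>) \<longleftrightarrow> transl \<phi> x = x"
    using ** by (metis rangeE rangeI)
qed

text \<open>The range is the set of fixed points. The module property yields closure under products,
  and the covariance \<open>comult_transl\<close> yields the coidalgebra condition.\<close>

lemma range_transl_coidalgebra:
  assumes "idempotent_state \<Delta> \<phi>"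
  shows "right_coidalgebra \<Delta> (range (transl \<phi>))"
proof -
  note \<phi> = idempotent_stateD[OF assms]
  have id: "clinear (id :: 'a \<Rightarrow> 'a)" by (simp add: clinear_iff)
  have "tensor_map id (transl \<phi>) t \<in> cspan {a \<otimes>\<^sub>C c | a c. c \<in> range (transl \<phi>)}" for t :: "('a, 'a) tensor"
  proof (induction t rule: tensor_induct)
    case (elem a b)
    show ?case
      unfolding tensor_map_elem[OF id clinear_transl(1)[OF \<phi>(1)]] by (rule cvs.span_base) auto
  next
    case (add t t')
    moreover have "tensor_map id (transl \<phi>) (t + t') = tensor_map id (transl \<phi>) t + tensor_map id (transl \<phi>) t'"
      using clinear_tensor_map[OF id clinear_transl(1)[OF \<phi>(1)]] unfolding clinear_iff by blast
    ultimately show ?case by (simp only: cvs.span_add)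
  qed
  then have "\<Delta> ` range (transl \<phi>) \<subseteq> cspan {a \<otimes>\<^sub>C c | a c. c \<in> range (transl \<phi>)}"
    by (auto simp only: comult_transl[OF \<phi>(1)] image_iff)
  moreover have "x * y \<in> range (transl \<phi>)" "star x \<in> range (transl \<phi>)"
    if "x \<in> range (transl \<phi>)" "y \<in> range (transl \<phi>)" for x y
    using that transl_module[OF \<phi>(2,3)] transl_star(1)[OF \<phi>(2)] by (simp_all add: \<phi>(7))
  moreover have "1 \<in> range (transl \<phi>)" using \<phi>(6,7) by blast
  ultimately show ?thesis
    using csubspace_range[OF clinear_transl(1)[OF \<phi>(1)]] by (simp add: right_coidalgebra_def)
qed

text \<open>If x lies in the range then so does \<open>star x\<close>, and preservation of h
  together with the module property lets \<open>transl \<phi>\<close> act on a alone in h(a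
  \<open>star x\<close>). Traciality moves \<open>star x\<close> to the left, where orthogonality is
  formulated.\<close>

lemma transl_eq_ortho_proj:
  assumes \<phi>: "idempotent_state \<Delta> \<phi>" and B: "orthogonal_set h B" "cspan B = range (transl \<phi>)"
  shows "ortho_proj h B a = transl \<phi> a"
proof (rule ortho_proj_unique[OF haar_faithful B(1)])
  note \<phi>' = idempotent_stateD[OF \<phi>]
  show "transl \<phi> a \<in> cspan B" by (simp add: B)
  fix x assume "x \<in> cspan B"
  then have "transl \<phi> (star x) = star x"
    using transl_star(1)[OF \<phi>'(2)] by (simp add: B \<phi>'(7))
  then have "h (a * star x) = h (transl \<phi> a * star x)"
    using haar_transl[OF \<phi>'(1,3), of "a * star x"] transl_module[OF \<phi>'(2,3)] by simp
  then show "h (star x * (a - transl \<phi> a)) = 0"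
    by (simp add: right_diff_distrib clinear_diff[OF clinear_haar] haar_trace[of "star x"])
qed

lemma range_transl_inject:
  assumes "idempotent_state \<Delta> \<phi>" "idempotent_state \<Delta> \<psi>" "range (transl \<phi>) = range (transl \<psi>)"
  shows "\<phi> = \<psi>"
proof -
  obtain S :: "'a set" where S: "finite S" "cspan S = UNIV" by (rule finite_dim_exists)
  note \<phi> = idempotent_stateD[OF assms(1)] and \<psi> = idempotent_stateD[OF assms(2)]
  obtain B where "orthogonal_set h B" "cspan B = range (transl \<phi>)"
    using orthogonal_basis_exists[OF haar_faithful S csubspace_range[OF clinear_transl(1)[OF \<phi>(1)]]] .
  then have "transl \<phi> a = transl \<psi> a" for a
    using transl_eq_ortho_proj assms by metis
  then show ?thesis by (rule transl_inject[OF \<phi>(1) \<psi>(1)])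
qed

text \<open>Translations determine functionals, so the equation can be checked on operators, where
  it says that \<open>transl \<phi>\<close> fixes every value of
  \<open>transl \<psi>\<close>.\<close>

lemma convolution_iff_range:
  assumes "idempotent_state \<Delta> \<phi>" "idempotent_state \<Delta> \<psi>"
  shows "convolution \<Delta> \<phi> \<psi> = \<psi> \<longleftrightarrow> range (transl \<psi>) \<subseteq> range (transl \<phi>)"
proof -
  note \<phi> = idempotent_stateD[OF assms(1)] and \<psi> = idempotent_stateD[OF assms(2)]
  have "convolution \<Delta> \<phi> \<psi> = \<psi> \<longleftrightarrow> (\<forall>a. transl (convolution \<Delta> \<phi> \<psi>) a = transl \<psi> a)"
    using transl_inject[OF clinear_convolution[OF \<phi>(1) \<psi>(1)] \<psi>(1)] by auto
  also have "\<dots> \<longleftrightarrow> range (transl \<psi>) \<subseteq> range (transl \<phi>)"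
    unfolding transl_transl[OF \<phi>(1) \<psi>(1), symmetric] image_subset_iff \<phi>(7) by simp
  finally show ?thesis .
qed

section \<open>From coidalgebras to idempotent states\<close>

lemma haar_product_trace:
  "product_functional h h (s * t) = product_functional h h (t * s)"
proof (induction s rule: tensor_induct)
  case (elem a b)
  show ?case
    by (induction t rule: tensor_induct)
      (simp_all add: times_tensor_elem product_functional_elem clinear_haar haar_trace[of a] haar_trace[of b]
        distrib_left distrib_right clinear_product_functional[OF clinear_haar clinear_haar, unfolded clinear_iff])
qed (simp add: distrib_left distrib_right
    clinear_product_functional[OF clinear_haar clinear_haar, unfolded clinear_iff])

lemma haar_product_comult:
  "product_functional h h ((a \<otimes>\<^sub>C 1) * \<Delta> z) = h a * h z"
proof -
  have "product_functional h h ((a \<otimes>\<^sub>C 1) * \<Delta> z) = h (a * transl h z)"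
    by (simp add: product_functional_slice(1) clinear_haar slice_right_times transl_def)
  then show ?thesis
    using clinear_haar by (simp add: haar_right mult_scaleC_right) (simp add: clinear_iff)
qed

lemma right_coidalgebraD:
  assumes "right_coidalgebra \<Delta> C"
  shows "csubspace C" "1 \<in> C" "x \<in> C \<Longrightarrow> y \<in> C \<Longrightarrow> x * y \<in> C" "x \<in> C \<Longrightarrow> star x \<in> C"
    "x \<in> C \<Longrightarrow> \<Delta> x \<in> cspan {a \<otimes>\<^sub>C c | a c. c \<in> C}"
  using assms by (auto simp: right_coidalgebra_def)

text \<open>Since \<open>A \<otimes> C\<close> is finite-dimensional, the injective map \<open>a \<otimes> c \<mapsto> \<Delta>(c)(a \<otimes> 1)\<close> maps it onto
  itself.\<close>

lemma coidalgebra_galois_eq: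
  assumes C: "right_coidalgebra \<Delta> C" and "clinear f" "clinear g"
    and eq: "\<And>a c. c \<in> C \<Longrightarrow> f (\<Delta> c * (a \<otimes>\<^sub>C 1)) = g (\<Delta> c * (a \<otimes>\<^sub>C 1))"
    and u: "u \<in> cspan {a \<otimes>\<^sub>C c | a c. c \<in> C}"
  shows "f u = g u"
proof -
  let ?G = "{(a::'a) \<otimes>\<^sub>C c | a c. c \<in> C}"
  obtain S :: "('a, 'a) tensor set" where S: "finite S" "cspan S = UNIV" by (rule finite_dim_tensor_exists)
  have right: "t * (a \<otimes>\<^sub>C 1) \<in> cspan ?G" if "t \<in> cspan ?G" for t a
    using that
  proof (induction rule: cvs.span_induct_alt)
    case (step k x t)
    then obtain b c where "x = b \<otimes>\<^sub>C c" "c \<in> C" by blast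
    then have "x * (a \<otimes>\<^sub>C 1) = (b * a) \<otimes>\<^sub>C c" by (simp add: times_tensor_elem)
    with \<open>c \<in> C\<close> have "x * (a \<otimes>\<^sub>C 1) \<in> ?G" by blast
    with step show ?case
      by (simp only: distrib_right mult_scaleC_left cvs.span_add cvs.span_scale cvs.span_base)
  qed (simp add: cvs.span_zero)
  have "galois t \<in> cspan ?G" if "t \<in> cspan ?G" for t
    using that
  proof (induction rule: cvs.span_induct_alt)
    case base
    then show ?case by (simp add: clinear_zero[OF clinear_galois(1)] cvs.span_zero)
  next
    case (step k x t)
    then have "galois x \<in> cspan ?G"
      using right right_coidalgebraD(5)[OF C] by (auto simp: galois_elem)
    moreover have "galois (k *\<^sub>C x + t) = k *\<^sub>C galois x + galois t"
      using clinear_galois(1) by (simp add: clinear_iff)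
    ultimately show ?case using step by (simp only: cvs.span_add cvs.span_scale)
  qed
  then have "galois ` cspan ?G = cspan ?G"
    by (intro clinear_inj_image_subspace[OF S clinear_galois(1) inj_galois(1) cvs.subspace_span]) blast
  with u obtain w where w: "w \<in> cspan ?G" "u = galois w" by blast
  have "f (galois w) = g (galois w)"
    by (rule clinear_eq_on_span[OF clinear_compose[OF assms(2) clinear_galois(1)]
          clinear_compose[OF assms(3) clinear_galois(1)] _ w(1)]) (auto simp: galois_elem eq)
  then show ?thesis by (simp add: w)
qed

lemma coidalgebra_idempotent_state:
  assumes C: "right_coidalgebra \<Delta> C"
  obtains \<phi> where "idempotent_state \<Delta> \<phi>" "range (transl \<phi>) = C"
proof -
  note C' = right_coidalgebraD[OF C]
  note lin = clinear_haar
  let ?G = "{(a::'a) \<otimes>\<^sub>C c | a c. c \<in> C}"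
  obtain S :: "'a set" where S: "finite S" "cspan S = UNIV" by (rule finite_dim_exists)
  obtain B where B: "orthogonal_set h B" "cspan B = C"
    using orthogonal_basis_exists[OF haar_faithful S C'(1)] .
  define E where "E = ortho_proj h B"
  have linE: "clinear E" unfolding E_def by (rule clinear_ortho_proj[OF lin])
  have E_in: "E a \<in> C" for a using ortho_proj_in_span[of h B a] by (simp add: E_def B)
  have E_id: "E c = c" if "c \<in> C" for c
    using that ortho_proj_fixed[OF haar_faithful B(1)] by (simp add: E_def B)
  have E_unique: "E a = b" if "b \<in> C" "\<And>x. x \<in> C \<Longrightarrow> h (star x * (a - b)) = 0" for a b
    using ortho_proj_unique[OF haar_faithful B(1)] that by (simp add: E_def B)
  have E_orth: "h (c * (a - E a)) = 0" if "c \<in> C" for c a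
    using ortho_proj_orthogonal[OF haar_faithful B(1), of "star c" a] that C'(4)
    by (simp add: E_def B star_star)
  have E_haar: "h (c * E a) = h (c * a)" if "c \<in> C" for c a
    using E_orth[OF that, of a] by (simp add: right_diff_distrib clinear_diff[OF lin])
  \<comment> \<open>Orthogonality of c(a - E a) to x is orthogonality of a - E a to
    \<open>star c * x\<close>, which again lies in C.\<close>
  have E_left: "E (c * a) = c * E a" if "c \<in> C" for c a
  proof (rule E_unique)
    show "c * E a \<in> C" using that E_in C'(3) by blast
    fix x assume "x \<in> C"
    then have "h ((star x * c) * (a - E a)) = 0" using that C'(3,4) E_orth by blast
    then show "h (star x * (c * a - c * E a)) = 0"
      by (simp add: right_diff_distrib mult.assoc)
  qed
  \<comment> \<open>Traciality makes orthogonality to C invariant under the involution.\<close>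
  have E_star: "E (star a) = star (E a)" for a
  proof (rule E_unique)
    show "star (E a) \<in> C" using E_in C'(4) by blast
    fix x assume "x \<in> C"
    then have "h (star (x * (a - E a))) = 0"
      using E_orth positive_functional_star[OF haar_positive] by simp
    then show "h (star x * (star a - star (E a))) = 0"
      by (simp add: star_mult star_diff haar_trace[of "star x"])
  qed
  let ?H = "product_functional h h"
  have linH: "clinear ?H" by (rule clinear_product_functional[OF lin lin])
  have id: "clinear (id :: 'a \<Rightarrow> 'a)" by (simp add: clinear_iff)
  note linM = clinear_tensor_map[OF id linE]
  have mult: "clinear (\<lambda>u. ?H (u * t))" "clinear (\<lambda>t. ?H (u * t))" for t u
    using linH by (simp_all add: clinear_iff distrib_right distrib_left mult_scaleC_left mult_scaleC_right)
  have cov: "\<Delta> (E a) = tensor_map id E (\<Delta> a)" for a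
  proof -
    \<comment> \<open>X lies in A \<otimes> C, hence so does \<open>star X\<close>. Both terms of X
      have the same product functional against every u in A \<otimes> C; taking u =
      \<open>star X\<close> gives X = 0, because h \<otimes> h is faithful.\<close>
    define X where "X = \<Delta> (E a) - tensor_map id E (\<Delta> a)"
    have "tensor_map id E t \<in> cspan ?G" for t :: "('a, 'a) tensor"
    proof (induction t rule: tensor_induct)
      case (elem x y)
      show ?case unfolding tensor_map_elem[OF id linE] using E_in by (intro cvs.span_base) blast
    next
      case (add t t')
      then show ?case using linM unfolding clinear_iff by (simp only: cvs.span_add)
    qed
    then have "X \<in> cspan ?G"
      unfolding X_def by (intro cvs.span_diff C'(5) E_in)
    then have star_X: "star X \<in> cspan ?G"
    proof (induction rule: cvs.span_induct_alt)
      case (step k x t)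
      then obtain b c where "x = b \<otimes>\<^sub>C c" "c \<in> C" by blast
      then have "star x = star b \<otimes>\<^sub>C star c" by (simp add: star_tensor_elem)
      with C'(4)[OF \<open>c \<in> C\<close>] have "star x \<in> ?G" by blast
      with step show ?case
        by (simp only: star_add star_scaleC cvs.span_add cvs.span_scale cvs.span_base)
    qed (simp add: cvs.span_zero)
    have proj: "?H (u * tensor_map id E t) = ?H (u * t)" if "u \<in> cspan ?G" for u t
    proof (rule clinear_eq_on_span[OF mult(1) mult(1) _ that])
      fix u assume "u \<in> ?G"
      then obtain x c where u: "u = x \<otimes>\<^sub>C c" "c \<in> C" by blast
      show "?H (u * tensor_map id E t) = ?H (u * t)"
        by (rule clinear_eq_tensor[OF clinear_compose[OF mult(2) linM] mult(2)])
          (simp add: u tensor_map_elem id linE times_tensor_elem product_functional_elem lin E_haar)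
    qed
    have "?H (u * \<Delta> (E a)) = ?H (u * \<Delta> a)" if "u \<in> cspan ?G" for u
    proof (rule coidalgebra_galois_eq[OF C mult(1) mult(1) _ that])
      fix x c assume c: "c \<in> C"
      \<comment> \<open>By traciality and invariance the value depends on y only through h(c y),
        which does not distinguish E a from a.\<close>
      have "?H (\<Delta> c * (x \<otimes>\<^sub>C 1) * \<Delta> y) = h x * h (c * y)" for y
      proof -
        have "?H (\<Delta> c * (x \<otimes>\<^sub>C 1) * \<Delta> y) = ?H ((x \<otimes>\<^sub>C 1) * \<Delta> (y * c))"
          using haar_product_trace[of "\<Delta> c" "(x \<otimes>\<^sub>C 1) * \<Delta> y"] by (simp add: comult_mult mult.assoc)
        then show ?thesis by (simp add: haar_product_comult haar_trace[of y])
      qed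
      then show "?H (\<Delta> c * (x \<otimes>\<^sub>C 1) * \<Delta> (E a)) = ?H (\<Delta> c * (x \<otimes>\<^sub>C 1) * \<Delta> a)"
        by (simp add: E_haar[OF c])
    qed
    from this[OF star_X] proj[OF star_X, of "\<Delta> a"] have "?H (star X * X) = 0"
      by (simp add: X_def right_diff_distrib clinear_diff[OF linH])
    moreover have "faithful_functional ?H"
      using product_functional_positive(2)[OF S haar_faithful haar_positive haar_faithful] .
    ultimately have "X = 0" unfolding faithful_functional_def by blast
    then show ?thesis by (simp add: X_def)
  qed
  obtain \<phi> where lin\<phi>: "clinear \<phi>" and \<phi>: "\<And>a. transl \<phi> a = E a"
    using covariant_is_transl[OF linE cov] by blast
  have conv: "convolution \<Delta> \<phi> \<phi> = \<phi>"
    by (rule transl_inject[OF clinear_convolution[OF lin\<phi> lin\<phi>] lin\<phi>])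
      (simp add: \<phi> E_id E_in flip: transl_transl[OF lin\<phi> lin\<phi>])
  have \<phi>E: "\<phi> (E a) = \<phi> a" for a
    using convolution_transl(1)[OF lin\<phi> lin\<phi>, of a] by (simp add: conv \<phi>)
  have slice: "slice_right \<phi> (\<Delta> b * (a \<otimes>\<^sub>C 1)) = E b * a" for a b
    by (simp add: slice_right_times lin\<phi> \<phi>[unfolded transl_def])
  have one: "\<phi> 1 = 1"
  proof -
    have "\<phi> 1 *\<^sub>C 1 = (1::'a)"
      using \<phi>[of 1] by (simp add: transl_def comult_one one_tensor_elem slice_elem lin\<phi> E_id C'(2))
    then have "(\<phi> 1 - 1) *\<^sub>C (1::'a) = 0"
      by (simp add: cvs.scale_left_diff_distrib scaleC_one)
    then show ?thesis by simp
  qed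
  have \<phi>_star: "\<phi> (star a) = cnj (\<phi> a)" for a
  proof -
    \<comment> \<open>The conjugate functional has the translation a \<mapsto>
      \<open>star (E (star a))\<close>, which is E again, so it coincides with \<phi>.\<close>
    define \<psi> where "\<psi> y = cnj (\<phi> (star y))" for y
    have lin\<psi>: "clinear \<psi>" using lin\<phi> by (simp add: \<psi>_def clinear_iff star_add star_scaleC)
    have \<psi>: "cnj (\<phi> (star y)) = \<psi> y" for y by (simp add: \<psi>_def)
    have slice_\<psi>: "slice_right \<psi> t = star (slice_right \<phi> (star t))" for t :: "('a, 'a) tensor"
      by (induction t rule: tensor_induct)
        (simp_all add: slice_elem lin\<phi> lin\<psi> \<psi> star_tensor_elem star_add star_scaleC star_star
          clinear_slice(1)[OF lin\<phi>, unfolded clinear_iff] clinear_slice(1)[OF lin\<psi>, unfolded clinear_iff])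
    have "transl \<psi> a = star (transl \<phi> (star a))" for a
      by (simp only: transl_def comult_star slice_\<psi>)
    then have "transl \<psi> a = E a" for a
      by (simp add: \<phi> E_star star_star)
    then have "\<psi> = \<phi>" by (intro transl_inject[OF lin\<psi> lin\<phi>]) (simp add: \<phi>)
    then have "cnj (\<phi> (star a)) = \<phi> a" unfolding \<psi>_def by (rule fun_cong)
    then show ?thesis by (metis complex_cnj_cnj)
  qed
  \<comment> \<open>The slice id \<otimes> \<phi> is shown to be multiplicative when the left factor
    lies in A \<otimes> C; the tensors 1 \<otimes> c and 1 \<otimes> y then give the claim for
    \<phi>.\<close>
  have \<phi>_mult: "\<phi> (c * y) = \<phi> c * \<phi> y" if c: "c \<in> C" for c y
  proof -
    have linS: "clinear (slice_right \<phi> :: ('a, 'a) tensor \<Rightarrow> 'a)"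
      by (rule clinear_slice(1)[OF lin\<phi>])
    have left: "slice_right \<phi> (\<Delta> c * t) = c * slice_right \<phi> t" if c: "c \<in> C" for c t
    proof -
      have "slice_right \<phi> (\<Delta> c * galois s) = c * slice_right \<phi> (galois s)" for s
      proof (induction s rule: tensor_induct)
        case (elem a b)
        have "slice_right \<phi> (\<Delta> (c * b) * (a \<otimes>\<^sub>C 1)) = c * (E b * a)"
          unfolding slice by (simp add: E_left[OF c] mult.assoc)
        then show ?case by (simp add: galois_elem slice comult_mult mult.assoc)
      qed (simp add: clinear_galois(1)[unfolded clinear_iff] distrib_left linS[unfolded clinear_iff])
      moreover obtain s where "t = galois s" using surjD[OF surj_galois(1)] by blast
      ultimately show ?thesis by simp
    qed
    \<comment> \<open>A \<otimes> C is spanned by the elements \<Delta>(c)(a \<otimes> 1).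
      Multiplying by one of them from the left becomes, after slicing, left multiplication by c a,
      which is also its own slice because E c = c.\<close>
    have mult: "slice_right \<phi> (u * t) = slice_right \<phi> u * slice_right \<phi> t" if "u \<in> cspan ?G" for u t
    proof (rule coidalgebra_galois_eq[OF C _ _ _ that])
      show "clinear (\<lambda>u. slice_right \<phi> (u * t))" "clinear (\<lambda>u. slice_right \<phi> u * slice_right \<phi> t)"
        using linS by (simp_all add: clinear_iff distrib_right mult_scaleC_left)
      fix a c assume "c \<in> C"
      then show "slice_right \<phi> (\<Delta> c * (a \<otimes>\<^sub>C 1) * t) =
          slice_right \<phi> (\<Delta> c * (a \<otimes>\<^sub>C 1)) * slice_right \<phi> t"
        unfolding slice by (simp add: mult.assoc left slice_right_times lin\<phi> E_id)
    qed
    have "1 \<otimes>\<^sub>C c \<in> cspan ?G" using c by (intro cvs.span_base) blast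
    from mult[OF this, of "1 \<otimes>\<^sub>C y"]
    have "slice_right \<phi> ((1::'a) \<otimes>\<^sub>C (c * y)) = slice_right \<phi> ((1::'a) \<otimes>\<^sub>C c) * slice_right \<phi> (1 \<otimes>\<^sub>C y)"
      by (simp add: times_tensor_elem)
    then have "\<phi> (c * y) *\<^sub>C (1::'a) = (\<phi> c * \<phi> y) *\<^sub>C 1"
      by (simp add: slice_elem lin\<phi> mult_scaleC_left mult_scaleC_right scaleC_scaleC mult.commute)
    then show ?thesis by (rule cvs.scale_right_imp_eq[rotated]) simp
  qed
  \<comment> \<open>The Riesz representative of \<phi> with respect to h: it arises from \<phi>(a) =
    \<phi>(E a) by expanding E a in the orthogonal basis B.\<close>
  define p where "p = (\<Sum>e\<in>B. (\<phi> e / h (star e * e)) *\<^sub>C star e)"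
  have "p \<in> C"
    unfolding p_def using B C'(4)
    by (intro cvs.subspace_sum[OF C'(1)] cvs.subspace_scale[OF C'(1)]) (auto intro: cvs.span_base)
  have p: "\<phi> a = h (p * a)" for a
  proof -
    have "\<phi> a = \<phi> (\<Sum>e\<in>B. (h (star e * a) / h (star e * e)) *\<^sub>C e)"
      using \<phi>E[of a] by (simp add: E_def ortho_proj_def)
    also have "\<dots> = (\<Sum>e\<in>B. h (star e * a) / h (star e * e) * \<phi> e)"
      using lin\<phi> by (simp add: clinear_sum) (simp add: clinear_iff)
    also have "\<dots> = h (p * a)"
      using lin by (simp add: p_def sum_distrib_right clinear_sum mult_scaleC_left)
        (simp add: clinear_iff mult.commute)
    finally show ?thesis .
  qed
  have eqI: "x = y" if "\<And>a. h (x * a) = h (y * a)" for x y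
  proof -
    have "x - y = 0"
    proof (rule faithful_nondegenerate[OF haar_faithful])
      fix a
      have "h (a * (x - y)) = h ((x - y) * a)" by (rule haar_trace)
      also have "\<dots> = 0" using that by (simp add: left_diff_distrib clinear_diff[OF lin])
      finally show "h (a * (x - y)) = 0" .
    qed
    then show ?thesis by simp
  qed
  have "star p = p"
  proof (rule eqI)
    fix a
    have "h (star p * a) = cnj (h (star a * p))"
      using positive_functional_star[OF haar_positive, of "star a * p"] by (simp add: star_mult star_star)
    also have "\<dots> = h (p * a)"
      using \<phi>_star[of a] by (simp add: p haar_trace[of "star a"])
    finally show "h (star p * a) = h (p * a)" .
  qed
  \<comment> \<open>Multiplicativity at c = p: h(p p a) = \<phi>(p a) = \<phi>(p) \<phi>(a).\<close>
  have pp: "p * p = \<phi> p *\<^sub>C p"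
  proof (rule eqI)
    fix a
    show "h (p * p * a) = h ((\<phi> p *\<^sub>C p) * a)"
      using \<phi>_mult[OF \<open>p \<in> C\<close>, of a] lin by (simp add: p mult.assoc mult_scaleC_left) (simp add: clinear_iff p)
  qed
  have "p \<noteq> 0" using p[of 1] one clinear_zero[OF lin] by auto
  have "\<phi> p = h (star p * p)" by (simp add: p \<open>star p = p\<close>)
  then have p_pos: "\<phi> p \<in> \<real>\<^sub>\<ge>\<^sub>0" "\<phi> p \<noteq> 0"
    using haar_faithful \<open>p \<noteq> 0\<close>
    unfolding faithful_functional_def positive_functional_def by auto
  have "\<phi> (star a * a) \<in> \<real>\<^sub>\<ge>\<^sub>0" for a
  proof -
    \<comment> \<open>Traciality gathers the two factors p, and p p = \<phi>(p) p converts the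
      square of a p into a positive multiple of the value in question.\<close>
    have "h (star (a * p) * (a * p)) = h (p * p * (star a * a))"
      using haar_trace[of "p * star a * a" p] by (simp add: star_mult \<open>star p = p\<close> mult.assoc)
    also have "\<dots> = \<phi> p * \<phi> (star a * a)"
      using lin by (simp add: pp mult_scaleC_left) (simp add: clinear_iff p)
    finally have "\<phi> (star a * a) = inverse (\<phi> p) * h (star (a * p) * (a * p))"
      using p_pos(2) by simp
    moreover have "h (star (a * p) * (a * p)) \<in> \<real>\<^sub>\<ge>\<^sub>0"
      using haar_positive by (simp only: positive_functional_def)
    ultimately show ?thesis using p_pos(1) by (simp only: nonneg_Reals_mult_I nonneg_Reals_inverse_I)
  qed
  then have "idempotent_state \<Delta> \<phi>"
    using lin\<phi> one conv by (simp add: idempotent_state_def state_def)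
  moreover have "range (transl \<phi>) = C"
    using E_in E_id by (auto simp: \<phi>) (metis rangeI)
  ultimately show ?thesis by (rule that)
qed

end

section \<open>The lattices\<close>

lemma least_Upper_iso:
  assumes f: "bij_betw f (carrier L) (carrier M)"
    and le: "\<And>x y. x \<in> carrier L \<Longrightarrow> y \<in> carrier L \<Longrightarrow> le L x y \<longleftrightarrow> le M (f x) (f y)"
    and xy: "x \<in> carrier L" "y \<in> carrier L" "s \<in> carrier L"
  shows "least L s (Upper L {x, y}) \<longleftrightarrow> least M (f s) (Upper M {f x, f y})"
proof -
  have img: "carrier M = f ` carrier L" using f by (simp add: bij_betw_def)
  have "Upper M {f x, f y} = f ` Upper L {x, y}"
    unfolding Upper_def img using le xy by auto
  then show ?thesis
    unfolding least_def using le xy by (auto simp: img Upper_def)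
qed

text \<open>An order isomorphism pulls suprema and infima back, so L inherits the lattice property
  that \<open>join_pres\<close> and \<open>meet_pres\<close> demand on both sides. Joins and meets
  are chosen by description and are therefore compared through uniqueness of least and greatest
  bounds.\<close>

lemma order_iso_lattice_isomorphic:
  fixes L :: "'a gorder" and M :: "'b gorder"
  assumes M: "lattice M" and eq: "eq L = (=)"
    and f: "bij_betw f (carrier L) (carrier M)"
    and le: "\<And>x y. x \<in> carrier L \<Longrightarrow> y \<in> carrier L \<Longrightarrow> le L x y \<longleftrightarrow> le M (f x) (f y)"
  shows "lattice_isomorphic L M"
proof -
  interpret M: lattice M by (rule M)
  have in_M: "f x \<in> carrier M" if "x \<in> carrier L" for x
    using f that by (auto simp: bij_betw_def)
  have onto: "\<exists>x\<in>carrier L. f x = y" if "y \<in> carrier M" for y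
    using bij_betw_imp_surj_on[OF f] that by (metis imageE)
  have inj: "x = y" if "f x = f y" "x \<in> carrier L" "y \<in> carrier L" for x y
    using bij_betw_imp_inj_on[OF f] that by (rule inj_onD)
  have least: "least L s (Upper L {x, y}) \<longleftrightarrow> least M (f s) (Upper M {f x, f y})"
    if "x \<in> carrier L" "y \<in> carrier L" "s \<in> carrier L" for x y s
    by (rule least_Upper_iso) (simp_all add: f le that)
  have dual: "greatest L s (Lower L {x, y}) \<longleftrightarrow> greatest M (f s) (Lower M {f x, f y})"
    if "x \<in> carrier L" "y \<in> carrier L" "s \<in> carrier L" for x y s
  proof -
    \<comment> \<open>Infima are suprema of the inverse order, so the same lemma applies.\<close>
    have "least (inv_gorder L) s (Upper (inv_gorder L) {x, y}) \<longleftrightarrow>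
        least (inv_gorder M) (f s) (Upper (inv_gorder M) {f x, f y})"
      by (rule least_Upper_iso) (simp_all add: f le that)
    then show ?thesis by simp
  qed
  interpret L: partial_order L
  proof
    show "x .=\<^bsub>L\<^esub> y \<Longrightarrow> y .=\<^bsub>L\<^esub> z \<Longrightarrow> x .=\<^bsub>L\<^esub> z" for x y z by (simp add: eq)
    show "x .=\<^bsub>L\<^esub> y \<Longrightarrow> y .=\<^bsub>L\<^esub> x" for x y by (simp add: eq)
    show "x .=\<^bsub>L\<^esub> x" for x by (simp add: eq)
    show "le L x x" if "x \<in> carrier L" for x using that le in_M by simp
    show "x .=\<^bsub>L\<^esub> y" if "le L x y" "le L y x" "x \<in> carrier L" "y \<in> carrier L" for x y
      using that le in_M inj by (simp add: eq M.le_antisym)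
    show "le L x z" if "le L x y" "le L y z" "x \<in> carrier L" "y \<in> carrier L" "z \<in> carrier L" for x y z
      using that le in_M M.le_trans by meson
    show "le L x z \<longleftrightarrow> le L y w" if "x .=\<^bsub>L\<^esub> y" "z .=\<^bsub>L\<^esub> w" for x y z w
      using that by (simp add: eq)
    show "eq L = (=)" by (rule eq)
  qed
  interpret L: lattice L
  proof
    fix x y assume xy: "x \<in> carrier L" "y \<in> carrier L"
    show "\<exists>s. least L s (Upper L {x, y})"
      using M.sup_of_two_exists[OF in_M in_M, OF xy] least[OF xy] onto by (metis least_closed)
    show "\<exists>s. greatest L s (Lower L {x, y})"
      using M.inf_of_two_exists[OF in_M in_M, OF xy] dual[OF xy] onto by (metis greatest_closed)
  qed
  have "f (x \<squnion>\<^bsub>L\<^esub> y) = f x \<squnion>\<^bsub>M\<^esub> f y" if xy: "x \<in> carrier L" "y \<in> carrier L" for x y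
  proof (rule L.joinI[OF _ xy])
    fix l assume "least L l (Upper L {x, y})"
    then have l: "least M (f l) (Upper M {f x, f y})" using least[OF xy] by (metis least_closed)
    show "f l = f x \<squnion>\<^bsub>M\<^esub> f y"
    proof (rule M.joinI[OF _ in_M[OF xy(1)] in_M[OF xy(2)]])
      show "f l = s" if "least M s (Upper M {f x, f y})" for s
        using l that by (rule M.least_unique)
    qed
  qed
  moreover have "f (x \<sqinter>\<^bsub>L\<^esub> y) = f x \<sqinter>\<^bsub>M\<^esub> f y" if xy: "x \<in> carrier L" "y \<in> carrier L" for x y
  proof (rule L.meetI[OF _ xy])
    fix l assume "greatest L l (Lower L {x, y})"
    then have l: "greatest M (f l) (Lower M {f x, f y})" using dual[OF xy] by (metis greatest_closed)
    show "f l = f x \<sqinter>\<^bsub>M\<^esub> f y"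
    proof (rule M.meetI[OF _ in_M[OF xy(1)] in_M[OF xy(2)]])
      show "f l = s" if "greatest M s (Lower M {f x, f y})" for s
        using l that by (rule M.greatest_unique)
    qed
  qed
  ultimately show ?thesis
    using f L.lattice_axioms M.lattice_axioms
    by (auto simp: lattice_isomorphic_def join_pres_def meet_pres_def)
qed

section \<open>The lattice of coidalgebras under inclusion\<close>

context finite_qg
begin

text \<open>The delicate condition is the one on \<Delta>: forming A \<otimes> C has to commute with
  intersections over C, which the slice criterion makes immediate.\<close>

lemma right_coidalgebra_Inter:
  assumes "\<And>C. C \<in> \<C> \<Longrightarrow> right_coidalgebra \<Delta> C"
  shows "right_coidalgebra \<Delta> (\<Inter>\<C>)"
proof -
  obtain S :: "'a set" where S: "finite S" "cspan S = UNIV" by (rule finite_dim_exists)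
  obtain I :: "'a set" and e :: "'a \<Rightarrow> 'a" and \<phi> where fr: "frame I e \<phi>"
    using S by (rule frame_exists)
  have sub: "csubspace C" if "C \<in> \<C>" for C
    using assms[OF that] by (simp add: right_coidalgebra_def)
  then have sub': "csubspace (\<Inter>\<C>)" by (auto simp: cvs.subspace_def)
  have "\<Delta> x \<in> cspan {a \<otimes>\<^sub>C c | a c. c \<in> \<Inter>\<C>}" if "x \<in> \<Inter>\<C>" for x
    unfolding tensor_subspace_iff[OF fr sub']
  proof (intro allI impI InterI)
    fix f C assume f: "clinear (f :: 'a \<Rightarrow> complex)" and C: "C \<in> \<C>"
    have "\<Delta> x \<in> cspan {a \<otimes>\<^sub>C c | a c. c \<in> C}"
      using assms[OF C] that C by (auto simp: right_coidalgebra_def)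
    then show "tensor_lift (\<lambda>a b. f a *\<^sub>C b) (\<Delta> x) \<in> C"
      using f tensor_subspace_iff[OF fr sub[OF C]] by blast
  qed
  moreover have "1 \<in> \<Inter>\<C>" "x \<in> \<Inter>\<C> \<Longrightarrow> y \<in> \<Inter>\<C> \<Longrightarrow> x * y \<in> \<Inter>\<C>" "x \<in> \<Inter>\<C> \<Longrightarrow> star x \<in> \<Inter>\<C>" for x y
    using assms unfolding right_coidalgebra_def by blast+
  ultimately show ?thesis using sub' unfolding right_coidalgebra_def by blast
qed

text \<open>Suprema exist because arbitrary intersections do: the join of C and D is the
  intersection of all coidalgebras that contain both.\<close>

lemma lattice_right_coidalgebras: "lattice (right_coidalgebras \<Delta>)"
proof -
  let ?L = "right_coidalgebras \<Delta>"
  interpret partial_order ?L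
    by unfold_locales (auto simp: right_coidalgebras_def)
  show ?thesis
  proof
    fix C D assume "C \<in> carrier ?L" "D \<in> carrier ?L"
    then have CD: "right_coidalgebra \<Delta> C" "right_coidalgebra \<Delta> D"
      by (simp_all add: right_coidalgebras_def)
    have "right_coidalgebra \<Delta> (\<Inter>{C, D})"
      using CD by (intro right_coidalgebra_Inter) auto
    then show "\<exists>s. greatest ?L s (Lower ?L {C, D})"
      using CD by (intro exI[of _ "\<Inter>{C, D}"]) (auto simp: greatest_def Lower_def right_coidalgebras_def)
    let ?S = "{U. right_coidalgebra \<Delta> U \<and> C \<subseteq> U \<and> D \<subseteq> U}"
    have "right_coidalgebra \<Delta> (\<Inter>?S)"
      by (intro right_coidalgebra_Inter) auto
    then show "\<exists>s. least ?L s (Upper ?L {C, D})"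
      using CD by (intro exI[of _ "\<Inter>?S"]) (auto simp: least_def Upper_def right_coidalgebras_def)
  qed
qed

end

theorem corollary3p4:
  fixes \<Delta> :: "'a::cstar_algebra \<Rightarrow> ('a, 'a) tensor"
  assumes "finite_quantum_group \<Delta>"
  shows "lattice_isomorphic (idempotent_states \<Delta>) (inv_gorder (right_coidalgebras \<Delta>))"
proof -
  interpret finite_qg \<Delta> using assms by unfold_locales
  obtain h where h: "faithful_functional h" "h 1 = 1" "\<And>a b. h (a * b) = h (b * a)"
    "\<And>a. transl h a = h a *\<^sub>C 1" "\<And>a. transl' h a = h a *\<^sub>C 1"
    using haar_exists by blast
  interpret haar_qg \<Delta> h using h by unfold_locales
  show ?thesis
  proof (rule order_iso_lattice_isomorphic)
    show "lattice (inv_gorder (right_coidalgebras \<Delta>))"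
      by (rule lattice.dual_lattice[OF lattice_right_coidalgebras])
    show "eq (idempotent_states \<Delta>) = (=)" by (simp add: idempotent_states_def)
    show "bij_betw (\<lambda>\<phi>. range (transl \<phi>)) (carrier (idempotent_states \<Delta>))
        (carrier (inv_gorder (right_coidalgebras \<Delta>)))"
      unfolding bij_betw_def
    proof
      show "inj_on (\<lambda>\<phi>. range (transl \<phi>)) (carrier (idempotent_states \<Delta>))"
        by (auto simp: idempotent_states_def intro!: inj_onI range_transl_inject)
      show "(\<lambda>\<phi>. range (transl \<phi>)) ` carrier (idempotent_states \<Delta>) =
          carrier (inv_gorder (right_coidalgebras \<Delta>))"
        using range_transl_coidalgebra coidalgebra_idempotent_state
        by (auto simp: idempotent_states_def right_coidalgebras_def image_iff) metis
    qed
    show "le (idempotent_states \<Delta>) \<phi> \<psi> \<longleftrightarrow>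
        le (inv_gorder (right_coidalgebras \<Delta>)) (range (transl \<phi>)) (range (transl \<psi>))"
      if "\<phi> \<in> carrier (idempotent_states \<Delta>)" "\<psi> \<in> carrier (idempotent_states \<Delta>)" for \<phi> \<psi>
      using that convolution_iff_range by (simp add: idempotent_states_def right_coidalgebras_def)
  qed
qed

end
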